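(* For any graph $F$, and every $n\geq 3$, $\mathrm{ex}_{\mathcal P}(n,F^{\mathrm{ind}})=3n-6$ whenever one of the following holds: (i) $F$ contains a $K_4$; (ii) $F$ contains an induced $C_k$, for $k\geq 4$ (i.e. $F$ is not chordal); (iii) $F$ contains an induced $S_k$, for $k\geq 3$ (i.e. $F$ is not claw-free); (iv) $F$ contains an induced copy of $2K_3$.
   Context: $C_k$ is the cycle on $k$ vertices, $S_k$ is the star with $k$ leaves (so it has $k+1$ vertices), $K_m$ is the complete graph on $m$ vertices, and $2K_3$ is the disjoint union of two copies of $K_3$. A graph $G$ is $F^{\mathrm{ind}}$-free if it contains no induced subgraph isomorphic to $F$. The induced planar Turán number of $F$ is $\mathrm{ex}_{\mathcal P}(n,F^{\mathrm{ind}}):=\max\{|E(G)| : G \text{ is an } n\text{-vertex planar graph and } F^{\mathrm{ind}}\text{-free}\}$.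
   Formalization: The claim fails, and is not asserted, in three instances of (i): F = K_4 with n = 4 or n = 5, and F = K_5 minus an edge with n = 5 (there the only planar graph with 3n-6 edges contains an induced F); all other cases are covered. *)

theory Defs
  imports "HOL-Analysis.Analysis"
begin

datatype 'a ugraph = Graph (verts: "'a set") (edges: "'a set set")

definition simple_graph :: "'a ugraph \<Rightarrow> bool" where
  "simple_graph G \<longleftrightarrow> finite (verts G) \<and> (\<forall>e\<in>edges G. e \<subseteq> verts G \<and> card e = 2)"

definition isomorphic :: "'a ugraph \<Rightarrow> 'b ugraph \<Rightarrow> bool" where
  "isomorphic G H \<longleftrightarrow>
     (\<exists>f. bij_betw f (verts G) (verts H) \<and>
          (\<forall>u\<in>verts G. \<forall>v\<in>verts G. {u, v} \<in> edges G \<longleftrightarrow> {f u, f v} \<in> edges H))"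

definition subgraph :: "'a ugraph \<Rightarrow> 'a ugraph \<Rightarrow> bool" where
  "subgraph H G \<longleftrightarrow> simple_graph H \<and> verts H \<subseteq> verts G \<and> edges H \<subseteq> edges G"

definition induced_subgraph :: "'a ugraph \<Rightarrow> 'a set \<Rightarrow> 'a ugraph" where
  "induced_subgraph G S = Graph S {e \<in> edges G. e \<subseteq> S}"

definition contains :: "'a ugraph \<Rightarrow> 'b ugraph \<Rightarrow> bool" where
  "contains G F \<longleftrightarrow> (\<exists>H. subgraph H G \<and> isomorphic H F)"

definition contains_induced :: "'a ugraph \<Rightarrow> 'b ugraph \<Rightarrow> bool" where
  "contains_induced G F \<longleftrightarrow> (\<exists>S \<subseteq> verts G. isomorphic (induced_subgraph G S) F)"

definition induced_free :: "'b ugraph \<Rightarrow> 'a ugraph \<Rightarrow> bool" where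
  "induced_free F G \<longleftrightarrow> \<not> contains_induced G F"

definition complete_graph :: "nat \<Rightarrow> nat ugraph" where
  "complete_graph m = Graph {..<m} {e. e \<subseteq> {..<m} \<and> card e = 2}"

text \<open>The cycle on k vertices; intended for k at least 3.\<close>

definition cycle_graph :: "nat \<Rightarrow> nat ugraph" where
  "cycle_graph k = Graph {..<k} {{i, Suc i mod k} | i. i < k}"

text \<open>The star with k leaves and centre 0, hence with k + 1 vertices.\<close>

definition star_graph :: "nat \<Rightarrow> nat ugraph" where
  "star_graph k = Graph {0..k} {{0, i} | i. i \<in> {1..k}}"

definition disjoint_union :: "'a ugraph \<Rightarrow> 'b ugraph \<Rightarrow> ('a + 'b) ugraph" where
  "disjoint_union G H =
     Graph (Inl ` verts G \<union> Inr ` verts H)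
           ((\<lambda>e. Inl ` e) ` edges G \<union> (\<lambda>e. Inr ` e) ` edges H)"

definition delete_edge :: "'a ugraph \<Rightarrow> 'a set \<Rightarrow> 'a ugraph" where
  "delete_edge G e = Graph (verts G) (edges G - {e})"

text \<open>A drawing in the plane (identified with the complex numbers): \<open>p\<close> places the vertices at
  distinct points, \<open>c e\<close> is a simple arc joining the two ends of \<open>e\<close> that meets no other vertex,
  and distinct arcs meet only in the ends their edges have in common.\<close>

definition plane_drawing ::
    "'a ugraph \<Rightarrow> ('a \<Rightarrow> complex) \<Rightarrow> ('a set \<Rightarrow> real \<Rightarrow> complex) \<Rightarrow> bool" where
  "plane_drawing G p c \<longleftrightarrow>
     inj_on p (verts G) \<and>
     (\<forall>e\<in>edges G. arc (c e) \<and> {pathstart (c e), pathfinish (c e)} = p ` e \<and>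
                   path_image (c e) \<inter> p ` verts G = p ` e) \<and>
     (\<forall>e\<in>edges G. \<forall>e'\<in>edges G. e \<noteq> e' \<longrightarrow>
        path_image (c e) \<inter> path_image (c e') = p ` (e \<inter> e'))"

definition planar :: "'a ugraph \<Rightarrow> bool" where
  "planar G \<longleftrightarrow> (\<exists>p c. plane_drawing G p c)"

text \<open>Every finite graph is isomorphic to one with vertices in \<open>nat\<close>, so the host graphs may be
  taken of that type. The set below is finite; \<open>Max\<close> is meaningful only where it is nonempty.\<close>

definition ex_planar_induced :: "nat \<Rightarrow> 'a ugraph \<Rightarrow> nat" where
  "ex_planar_induced n F =
     Max {card (edges G) | G :: nat ugraph.
            simple_graph G \<and> card (verts G) = n \<and> planar G \<and> induced_free F G}"

end

theory Submission
  imports Defs "HOL-Complex_Analysis.Riemann_Mapping"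
begin

text \<open>For the upper bound, a drawing is weakened to path-connected sets, one per edge, that are
  disjoint for disjoint edges. Contracting an edge preserves this, and \<open>K\<^sub>5\<close> has no such drawing:
  a continuous logarithm of \<open>g s - h t\<close> on the unit square relates the winding numbers of two
  disjoint paths about each other's ends, and these relations contradict each other modulo 2.
  Mader's argument then bounds the number of edges by \<open>3 n - 6\<close>.

  The bound is attained by the cube of a path, which has neither induced cycles of length at least 4
  nor claws, and, for \<open>n \<ge> 6\<close>, by the double wheel, in which no \<open>K\<^sub>4\<close> and no induced \<open>2K\<^sub>3\<close> exists because
  every triangle uses one of the two nonadjacent hubs. For \<open>n \<le> 5\<close> the cube of a path serves
  in all cases, up to the exceptions excluded by the hypotheses.\<close>

section \<open>Nonplanarity of the complete graph on five vertices\<close>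

text \<open>Contracting an edge of an honest drawing would require redrawing arcs near that edge,
  whereas connected sets are simply united. The price is that \<open>K5\<close> must be refuted for
  paths that may cross themselves, and one another whenever their edges share a vertex.

  Neither extremal graph serves all four cases. The cube of a path has a \<open>K4\<close> on any
  four consecutive vertices and, from nine vertices on, an induced \<open>2K3\<close> such as
  \<open>{0, 1, 2}\<close> and \<open>{6, 7, 8}\<close>. The double wheel has its rim, of length at
  least 4, as an induced cycle, and it has claws at a hub once the rim has six vertices.

  The excluded cases are genuine: a graph with \<open>3 n - 6\<close> edges is \<open>K4\<close> for
  \<open>n = 4\<close> and \<open>K5\<close> minus an edge for \<open>n = 5\<close>, and the latter
  contains an induced \<open>K4\<close>.\<close>

lemma exp_lift_difference_unique:
  fixes g h :: "real \<Rightarrow> complex"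
  assumes "continuous_on {0..1} g" "continuous_on {0..1} h"
    and eq: "\<And>t. t \<in> {0..1} \<Longrightarrow> exp (g t) = c * exp (h t)"
  shows "g 1 - g 0 = h 1 - h 0"
proof -
  let ?d = "\<lambda>t. g t - h t"
  have exp_d: "exp (?d t) = c" if "t \<in> {0..1}" for t
    using eq[OF that] by (simp add: exp_diff)
  \<comment> \<open>\<open>exp\<close> of \<open>?d\<close> is the constant \<open>c\<close>, so
    distinct values of \<open>?d\<close> are at least \<open>2 * pi\<close> apart, and a continuous
    function on an interval cannot jump between them.\<close>
  have "?d constant_on {0..1::real}"
  proof (rule continuous_discrete_range_constant)
    show "connected {0..1::real}" by simp
    show "continuous_on {0..1} ?d" using assms by (intro continuous_intros)
    show "\<exists>e>0. \<forall>y. y \<in> {0..1} \<and> ?d y \<noteq> ?d x \<longrightarrow> e \<le> norm (?d y - ?d x)"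
      if "x \<in> {0..1}" for x
    proof (intro exI[of _ "2 * pi"] conjI allI impI)
      fix y assume y: "y \<in> {0..1} \<and> ?d y \<noteq> ?d x"
      then have "exp (?d y) = exp (?d x)" using exp_d that by simp
      then obtain n :: int where n: "?d y = ?d x + (of_int (2 * n) * pi) * \<i>"
        by (auto simp: exp_eq)
      then have "n \<noteq> 0" using y by auto
      then have "1 \<le> \<bar>real_of_int n\<bar>" by linarith
      moreover have "norm (?d y - ?d x) = 2 * pi * \<bar>real_of_int n\<bar>"
        using n by (simp add: norm_mult)
      ultimately show "2 * pi \<le> norm (?d y - ?d x)" by simp
    qed simp
  qed
  then have "?d 0 = ?d 1" by (auto simp: constant_on_def)
  then show ?thesis by (simp add: algebra_simps)
qed

text \<open>The factor \<open>c\<close> lets a single logarithm of \<open>g s - h t\<close> serve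
  both paths: as a function of \<open>s\<close> it lifts \<open>g\<close> around \<open>h t\<close>
  with \<open>c = 1\<close>, as a function of \<open>t\<close> it lifts \<open>h\<close> around
  \<open>g s\<close> with \<open>c = -1\<close>.\<close>

lemma winding_number_eq_log_difference:
  assumes "path g" "z \<notin> path_image g" "continuous_on {0..1} q"
    and q: "\<And>t. t \<in> {0..1} \<Longrightarrow> exp (q t) = c * (g t - z)"
  shows "q 1 - q 0 = 2 * of_real pi * \<i> * winding_number g z"
proof -
  obtain r where r: "path r" "pathfinish r - pathstart r = 2 * of_real pi * \<i> * winding_number g z"
    "\<And>t. t \<in> {0..1} \<Longrightarrow> g t = z + exp (r t)"
    using winding_number_as_continuous_log[OF assms(1,2)] by blast
  have "q 1 - q 0 = r 1 - r 0"
    using assms(3) r q by (intro exp_lift_difference_unique[of q r c]) (auto simp: path_def)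
  then show ?thesis using r(2) by (simp add: pathfinish_def pathstart_def)
qed

text \<open>Times 2 pi i, both sides equal \<open>q (1, 1) - q (0, 0)\<close> for a logarithm
  \<open>q\<close> of \<open>g s - h t\<close>, collected along the two ways round the boundary of
  the square. The paths may be open, so the winding numbers need not be integers.\<close>

lemma winding_number_reciprocity:
  assumes "path g" "path h" and disj: "path_image g \<inter> path_image h = {}"
  shows "winding_number g (pathstart h) + winding_number h (pathfinish g)
       = winding_number h (pathstart g) + winding_number g (pathfinish h)"
proof -
  let ?Q = "{0..1::real} \<times> {0..1::real}"
  have cont: "continuous_on ?Q (\<lambda>(s, t). g s - h t)"
    unfolding split_def using assms(1,2) unfolding path_def
    by (intro continuous_on_diff continuous_on_compose2[of "{0..1}" g _ fst]
        continuous_on_compose2[of "{0..1}" h _ snd] continuous_on_fst continuous_on_snd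
        continuous_on_id) auto
  have nz: "(\<lambda>(s, t). g s - h t) z \<noteq> 0" if "z \<in> ?Q" for z
    using that disj by (auto simp: path_image_def)
  have contr: "contractible ?Q" by (intro convex_imp_contractible convex_Times) auto
  obtain q where q: "continuous_on ?Q q" "\<And>z. z \<in> ?Q \<Longrightarrow> (\<lambda>(s, t). g s - h t) z = exp (q z)"
    using continuous_logarithm_on_contractible[OF cont contr nz] by metis
  have cont_q1: "continuous_on {0..1} (\<lambda>s. q (s, t))" if "t \<in> {0..1}" for t
    using that by (intro continuous_on_compose2[OF q(1)] continuous_on_Pair continuous_on_const continuous_on_id) auto
  have cont_q2: "continuous_on {0..1} (\<lambda>t. q (s, t))" if "s \<in> {0..1}" for s
    using that by (intro continuous_on_compose2[OF q(1)] continuous_on_Pair continuous_on_const continuous_on_id) auto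
  have notin: "h t \<notin> path_image g" "g t \<notin> path_image h" if "t \<in> {0..1}" for t
    using that disj unfolding path_image_def by blast+
  have g: "q (1, t) - q (0, t) = 2 * of_real pi * \<i> * winding_number g (h t)" if "t \<in> {0..1}" for t
    using that q(2) notin assms cont_q1[OF that]
    by (intro winding_number_eq_log_difference[where c = 1 and q = "\<lambda>s. q (s, t)"]) auto
  have h: "q (s, 1) - q (s, 0) = 2 * of_real pi * \<i> * winding_number h (g s)" if "s \<in> {0..1}" for s
    using that q(2)[symmetric] notin assms cont_q2[OF that]
    by (intro winding_number_eq_log_difference[where c = "-1" and q = "\<lambda>t. q (s, t)"]) auto
  have "2 * of_real pi * \<i> * (winding_number g (h 0) + winding_number h (g 1))
      = 2 * of_real pi * \<i> * (winding_number h (g 0) + winding_number g (h 1))"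
    using g[of 0] g[of 1] h[of 0] h[of 1] by (simp add: algebra_simps)
  then show ?thesis by (simp add: pathstart_def pathfinish_def)
qed

text \<open>Writing the winding number of \<open>g i j\<close> about \<open>p k\<close> as a difference of logarithms plus an integer
  \<open>n i j k\<close>, reciprocity says that \<open>n k l i + n i j l + n i j k + n k l j\<close> is odd exactly if the pairs
  interleave. Each \<open>n i j k\<close> occurs in two of the 15 relations, but five of them are odd.\<close>

lemma K5_paths_meet:
  fixes p :: "nat \<Rightarrow> complex" and g :: "nat \<Rightarrow> nat \<Rightarrow> real \<Rightarrow> complex"
  assumes path: "\<And>i j. i < j \<Longrightarrow> j < 5 \<Longrightarrow> path (g i j) \<and> pathstart (g i j) = p i \<and> pathfinish (g i j) = p j"
    and disj: "\<And>i j k l. i < j \<Longrightarrow> j < 5 \<Longrightarrow> k < l \<Longrightarrow> l < 5 \<Longrightarrow> {i, j} \<inter> {k, l} = {} \<Longrightarrow>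
        path_image (g i j) \<inter> path_image (g k l) = {}"
  shows False
proof -
  \<comment> \<open>A logarithm of \<open>p b - p a\<close> divided by 2 pi i, with branches matched
    so that swapping the arguments changes it by exactly 1/2. These halves are the source of the
    parity.\<close>
  define \<L> where "\<L> a b = (if a < b then Ln (p b - p a) / (2 * of_real pi * \<i>)
      else Ln (p a - p b) / (2 * of_real pi * \<i>) + 1 / 2)" for a b
  have off: "p k \<notin> path_image (g i j)" if "i < j" "j < 5" "k < 5" "k \<noteq> i" "k \<noteq> j" for i j k
  proof -
    \<comment> \<open>A fourth index \<open>l\<close> puts \<open>p k\<close> on the path between
      \<open>k\<close> and \<open>l\<close>, which is disjoint from the path between
      \<open>i\<close> and \<open>j\<close>.\<close>
    have "\<exists>l<5. l \<noteq> i \<and> l \<noteq> j \<and> l \<noteq> k"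
    proof (rule ccontr)
      assume "\<not> ?thesis"
      then have "{..<5} \<subseteq> {i, j, k}" by auto
      then have "card {..<5::nat} \<le> card {i, j, k}" by (intro card_mono) auto
      also have "\<dots> \<le> 3" by (simp add: card_insert_if)
      finally show False by simp
    qed
    then obtain l where l: "l < 5" "l \<noteq> i" "l \<noteq> j" "l \<noteq> k" by blast
    have "p k \<in> path_image (g (min k l) (max k l))"
      using path[of k l] path[of l k] l that
      by (metis (no_types) linorder_neqE_nat max.commute max.strict_order_iff min.commute min.strict_order_iff pathfinish_in_path_image pathstart_in_path_image)
    moreover have "path_image (g i j) \<inter> path_image (g (min k l) (max k l)) = {}"
      using l that by (intro disj) (auto simp: min_def max_def)
    ultimately show ?thesis by blast
  qed
  have p_neq: "p i \<noteq> p k" if "i < 5" "k < 5" "i \<noteq> k" for i k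
  proof -
    have "\<exists>j<5. j \<noteq> i \<and> j \<noteq> k"
    proof (rule ccontr)
      assume "\<not> ?thesis"
      then have "{..<5} \<subseteq> {i, k}" by auto
      then have "card {..<5::nat} \<le> card {i, k}" by (intro card_mono) auto
      also have "\<dots> \<le> 2" by (simp add: card_insert_if)
      finally show False by simp
    qed
    then obtain j where j: "j < 5" "j \<noteq> i" "j \<noteq> k" by blast
    show ?thesis
    proof (cases "i < j")
      case True
      then show ?thesis using off[of i j k] path[of i j] j that
        by (metis pathstart_in_path_image)
    next
      case False
      then show ?thesis using off[of j i k] path[of j i] j that
        by (metis linorder_neqE_nat pathfinish_in_path_image)
    qed
  qed
  have exp_\<L>: "exp (2 * of_real pi * \<i> * \<L> a b) = p b - p a" if "a < 5" "b < 5" "a \<noteq> b" for a b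
    using that p_neq[of a b] p_neq[of b a] by (simp add: \<L>_def distrib_left exp_add)
  have \<L>_flip: "\<L> b a = \<L> a b + 1 / 2" if "a < b" for a b
    using that by (simp add: \<L>_def)
  have "\<exists>n::int. winding_number (g i j) (p k) = \<L> k j - \<L> k i + of_int n"
    if "i < j" "j < 5" "k < 5" "k \<noteq> i" "k \<noteq> j" for i j k
  proof -
    have "p j - p k = exp (2 * of_real pi * \<i> * winding_number (g i j) (p k)) * (p i - p k)"
      using winding_number_exp_2pi[of "g i j" "p k"] path[of i j] off[of i j k] that by simp
    then have "exp (2 * of_real pi * \<i> * \<L> k j)
        = exp (2 * of_real pi * \<i> * winding_number (g i j) (p k) + 2 * of_real pi * \<i> * \<L> k i)"
      using that by (simp add: exp_\<L> exp_add)
    then obtain n :: int where "2 * of_real pi * \<i> * winding_number (g i j) (p k) + 2 * of_real pi * \<i> * \<L> k i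
      = 2 * of_real pi * \<i> * \<L> k j + (of_int (2 * n) * pi) * \<i>"
      by (metis exp_eq)
    then have "2 * of_real pi * \<i> * (winding_number (g i j) (p k) + \<L> k i) = 2 * of_real pi * \<i> * (\<L> k j + of_int n)"
      by (simp add: algebra_simps)
    then have "winding_number (g i j) (p k) + \<L> k i = \<L> k j + of_int n" by simp
    then show ?thesis by (auto simp: algebra_simps)
  qed
  then obtain n :: "nat \<Rightarrow> nat \<Rightarrow> nat \<Rightarrow> int" where n:
    "\<And>i j k. i < j \<Longrightarrow> j < 5 \<Longrightarrow> k < 5 \<Longrightarrow> k \<noteq> i \<Longrightarrow> k \<noteq> j \<Longrightarrow>
      winding_number (g i j) (p k) = \<L> k j - \<L> k i + of_int (n i j k)"
    by metis
  \<comment> \<open>After rearranging, the logarithms occur only in four differences of the form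
    \<open>\<L> a b - \<L> b a\<close>, each 1/2 or -1/2. They cancel for nested and for separate
    pairs and leave 1 for interleaving ones.\<close>
  have square: "\<L> k j - \<L> k i + of_int (n i j k) + (\<L> j l - \<L> j k + of_int (n k l j))
      = \<L> i l - \<L> i k + of_int (n k l i) + (\<L> l j - \<L> l i + of_int (n i j l))"
    if "i < j" "j < 5" "k < l" "l < 5" "{i, j} \<inter> {k, l} = {}" for i j k l
    using winding_number_reciprocity[of "g i j" "g k l"] path[of i j] path[of k l] disj[OF that] that
    by (simp add: n)
  have nested: "n k l i + n i j l = n i j k + n k l j"
    if "i < k" "k < l" "l < j" "j < 5" for i j k l
  proof -
    have "(of_int (n k l i + n i j l) :: complex) = of_int (n i j k + n k l j)"
      using square[of i j k l] that \<L>_flip[of i k] \<L>_flip[of i l] \<L>_flip[of k j] \<L>_flip[of l j]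
      by (simp add: algebra_simps)
    then show ?thesis by (simp only: of_int_eq_iff)
  qed
  have separate: "n k l i + n i j l = n i j k + n k l j"
    if "i < j" "j < k" "k < l" "l < 5" for i j k l
  proof -
    have "(of_int (n k l i + n i j l) :: complex) = of_int (n i j k + n k l j)"
      using square[of i j k l] that \<L>_flip[of i k] \<L>_flip[of i l] \<L>_flip[of j k] \<L>_flip[of j l]
      by (simp add: algebra_simps)
    then show ?thesis by (simp only: of_int_eq_iff)
  qed
  have crossing: "n k l i + n i j l + 1 = n i j k + n k l j \<or> n k l i + n i j l = n i j k + n k l j + 1"
    if "i < k" "k < j" "j < l" "l < 5" for i j k l
  proof -
    have "(of_int (n k l i + n i j l) :: complex) = of_int (n i j k + n k l j + 1)
      \<or> (of_int (n k l i + n i j l + 1) :: complex) = of_int (n i j k + n k l j)"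
      using square[of i j k l] that \<L>_flip[of i k] \<L>_flip[of i l] \<L>_flip[of k j] \<L>_flip[of j l]
      by (simp add: algebra_simps)
    then show ?thesis by (simp only: of_int_eq_iff) auto
  qed
  \<comment> \<open>Modulo 2 the signs are immaterial; with all of them positive the total is
    literally twice a sum.\<close>
  define odds where "odds i j k l = n k l i + n i j l + n i j k + n k l j" for i j k l
  have e1: "even (odds i j k l)" if "i < k" "k < l" "l < j" "j < 5" for i j k l
    using nested[OF that] unfolding odds_def by presburger
  have e2: "even (odds i j k l)" if "i < j" "j < k" "k < l" "l < 5" for i j k l
    using separate[OF that] unfolding odds_def by presburger
  have e3: "odd (odds i j k l)" if "i < k" "k < j" "j < l" "l < 5" for i j k l
    using crossing[OF that] unfolding odds_def by presburger
  \<comment> \<open>For each of the five 4-element subsets, the first row has its separate pairing,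
    the second its nested and the third its interleaving one.\<close>
  let ?S = "odds 0 1 2 3 + odds 0 1 2 4 + odds 0 1 3 4 + odds 0 2 3 4 + odds 1 2 3 4
      + odds 0 3 1 2 + odds 0 4 1 2 + odds 0 4 1 3 + odds 0 4 2 3 + odds 1 4 2 3
      + odds 0 2 1 3 + odds 0 2 1 4 + odds 0 3 1 4 + odds 0 3 2 4 + odds 1 3 2 4"
  have "?S = 2 * (n 0 1 2 + n 0 1 3 + n 0 1 4
      + n 0 2 1 + n 0 2 3 + n 0 2 4
      + n 0 3 1 + n 0 3 2 + n 0 3 4
      + n 0 4 1 + n 0 4 2 + n 0 4 3
      + n 1 2 0 + n 1 2 3 + n 1 2 4
      + n 1 3 0 + n 1 3 2 + n 1 3 4
      + n 1 4 0 + n 1 4 2 + n 1 4 3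
      + n 2 3 0 + n 2 3 1 + n 2 3 4
      + n 2 4 0 + n 2 4 1 + n 2 4 3
      + n 3 4 0 + n 3 4 1 + n 3 4 2)"
    unfolding odds_def mult_2 by (simp only: ac_simps)
  then have "even ?S" by simp
  moreover have "odd ?S" by (simp add: e1 e2 e3)
  ultimately show False by blast
qed

section \<open>The edge bound for planar graphs\<close>

text \<open>Nothing is asked of edges that share a vertex, which makes the notion stable under contraction.\<close>

definition weak_drawing :: "'v set set \<Rightarrow> ('v \<Rightarrow> complex) \<Rightarrow> ('v set \<Rightarrow> complex set) \<Rightarrow> bool" where
  "weak_drawing E p A \<longleftrightarrow>
     (\<forall>e\<in>E. path_connected (A e) \<and> p ` e \<subseteq> A e) \<and>
     (\<forall>e\<in>E. \<forall>e'\<in>E. e \<inter> e' = {} \<longrightarrow> A e \<inter> A e' = {})"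

definition weakly_planar :: "'v set set \<Rightarrow> bool" where
  "weakly_planar E \<longleftrightarrow> (\<exists>p A. weak_drawing E p A)"

definition nbrs :: "'v set set \<Rightarrow> 'v \<Rightarrow> 'v set" where
  "nbrs E v = {w. {v, w} \<in> E}"

text \<open>The vertex \<open>z\<close> is merged into \<open>u\<close>. As edges form a set, the
  parallel edges that arise from common neighbours coincide automatically.\<close>

definition contract :: "'v set set \<Rightarrow> 'v \<Rightarrow> 'v \<Rightarrow> 'v set set" where
  "contract E u z = {e \<in> E. z \<notin> e} \<union> (\<lambda>w. {u, w}) ` (nbrs E z - {u})"

lemma weakly_planar_mono: "weakly_planar E \<Longrightarrow> E' \<subseteq> E \<Longrightarrow> weakly_planar E'"
  unfolding weakly_planar_def weak_drawing_def by (meson subsetD)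

lemma planar_imp_weakly_planar: "planar G \<Longrightarrow> weakly_planar (edges G)"
proof -
  assume "planar G"
  then obtain p c where pc: "plane_drawing G p c" by (auto simp: planar_def)
  have "weak_drawing (edges G) p (\<lambda>e. path_image (c e))"
    unfolding weak_drawing_def
  proof (intro conjI ballI impI)
    fix e assume e: "e \<in> edges G"
    then have "arc (c e)" "path_image (c e) \<inter> p ` verts G = p ` e"
      using pc by (auto simp: plane_drawing_def)
    then show "path_connected (path_image (c e))" "p ` e \<subseteq> path_image (c e)"
      by (auto intro: path_connected_path_image arc_imp_path)
    fix e' assume "e' \<in> edges G" "e \<inter> e' = {}"
    with e show "path_image (c e) \<inter> path_image (c e') = {}"
      using pc by (cases "e = e'") (auto simp: plane_drawing_def)
  qed
  then show ?thesis by (auto simp: weakly_planar_def)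
qed

lemma nbrs_neq: "\<forall>e\<in>E. card e = 2 \<Longrightarrow> w \<in> nbrs E v \<Longrightarrow> w \<noteq> v"
  by (auto simp: nbrs_def)

text \<open>A redirected edge takes the sets of \<open>{z, w}\<close> and \<open>{u, z}\<close>,
  which meet in \<open>p z\<close>. Two redirected edges share \<open>u\<close>, so nothing is asked
  of them; a kept edge that avoids \<open>u\<close> and \<open>w\<close> also avoids
  \<open>z\<close>, hence both pieces.\<close>

lemma weakly_planar_contract:
  assumes wp: "weakly_planar E" and two: "\<forall>e\<in>E. card e = 2" and uz: "{u, z} \<in> E"
  shows "weakly_planar (contract E u z)"
proof -
  obtain p A where pA: "weak_drawing E p A" using wp by (auto simp: weakly_planar_def)
  \<comment> \<open>\<open>insert z (e - {u})\<close> undoes the redirection: it recovers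
    \<open>{z, w}\<close> from \<open>{u, w}\<close>.\<close>
  define A' where "A' e = (if e \<in> E \<and> z \<notin> e then A e else A (insert z (e - {u})) \<union> A {u, z})" for e
  have conn: "path_connected (A e)" "p ` e \<subseteq> A e" if "e \<in> E" for e
    using pA that by (auto simp: weak_drawing_def)
  have disj: "A e \<inter> A e' = {}" if "e \<in> E" "e' \<in> E" "e \<inter> e' = {}" for e e'
    using pA that by (simp add: weak_drawing_def)
  have u_neq_z: "u \<noteq> z" using two uz by fastforce
  have cases: "e \<in> E \<and> z \<notin> e \<and> A' e = A e \<or>
      (\<exists>w. e = {u, w} \<and> w \<noteq> u \<and> w \<noteq> z \<and> {z, w} \<in> E \<and> A' e = A {z, w} \<union> A {u, z})"
    if e: "e \<in> contract E u z" for e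
  proof (cases "e \<in> E \<and> z \<notin> e")
    case False
    then obtain w where w: "e = {u, w}" "w \<noteq> u" "{z, w} \<in> E"
      using e by (auto simp: contract_def nbrs_def)
    moreover have "w \<noteq> z" using w two by fastforce
    moreover have "insert z (e - {u}) = {z, w}" using w by auto
    ultimately show ?thesis using False by (auto simp: A'_def)
  qed (auto simp: A'_def)
  have "weak_drawing (contract E u z) p A'"
    unfolding weak_drawing_def
  proof (intro conjI ballI impI)
    fix e assume e: "e \<in> contract E u z"
    show "path_connected (A' e)"
      using cases[OF e]
    proof (elim disjE exE conjE)
      fix w assume w: "{z, w} \<in> E" "A' e = A {z, w} \<union> A {u, z}"
      have "p z \<in> A {z, w} \<inter> A {u, z}" using conn(2)[OF w(1)] conn(2)[OF uz] by auto
      then show ?thesis unfolding w(2) using conn(1) w uz by (intro path_connected_Un) auto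
    qed (auto intro: conn)
    show "p ` e \<subseteq> A' e"
      using cases[OF e]
    proof (elim disjE exE conjE)
      fix w assume w: "{z, w} \<in> E" "A' e = A {z, w} \<union> A {u, z}" "e = {u, w}"
      then show ?thesis using conn(2)[OF w(1)] conn(2)[OF uz] by auto
    qed (use conn(2) in auto)
  next
    fix e e' assume e: "e \<in> contract E u z" and e': "e' \<in> contract E u z" and ee: "e \<inter> e' = {}"
    have mixed: "A' e \<inter> A' e' = {}"
      if "e \<inter> e' = {}" "e = {u, w}" "{z, w} \<in> E" "A' e = A {z, w} \<union> A {u, z}"
        "e' \<in> E" "z \<notin> e'" "A' e' = A e'" for e e' w
    proof -
      have "{z, w} \<inter> e' = {}" "{u, z} \<inter> e' = {}" using that by auto
      then show ?thesis using disj[OF that(3,5)] disj[OF uz that(5)] that by blast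
    qed
    show "A' e \<inter> A' e' = {}"
      using cases[OF e]
    proof (elim disjE exE conjE)
      assume 1: "e \<in> E" "z \<notin> e" "A' e = A e"
      show ?thesis using cases[OF e']
      proof (elim disjE exE conjE)
        fix w assume "e' = {u, w}" "{z, w} \<in> E" "A' e' = A {z, w} \<union> A {u, z}"
        then show ?thesis using mixed[of e' e w] 1 ee by blast
      qed (use 1 ee disj in auto)
    next
      fix w assume 1: "e = {u, w}" "{z, w} \<in> E" "A' e = A {z, w} \<union> A {u, z}"
      show ?thesis using cases[OF e']
      proof (elim disjE exE conjE)
        fix w' assume "e' = {u, w'}"
        then show ?thesis using 1 ee by auto
      qed (use 1 ee mixed in blast)
    qed
  qed
  then show ?thesis by (auto simp: weakly_planar_def)
qed

section \<open>Counting edges at a vertex and under contraction\<close>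

lemma card_incident_edges:
  assumes "\<forall>e\<in>E. card e = 2"
  shows "card {e \<in> E. v \<in> e} = card (nbrs E v)"
proof -
  have "bij_betw (\<lambda>w. {v, w}) (nbrs E v) {e \<in> E. v \<in> e}"
    unfolding bij_betw_def
  proof
    show "inj_on (\<lambda>w. {v, w}) (nbrs E v)" by (auto simp: inj_on_def doubleton_eq_iff)
    show "(\<lambda>w. {v, w}) ` nbrs E v = {e \<in> E. v \<in> e}"
    proof (intro equalityI subsetI)
      fix e assume e: "e \<in> {e \<in> E. v \<in> e}"
      then obtain x y where "e = {x, y}" using assms by (metis (mono_tags) card_2_iff mem_Collect_eq)
      with e show "e \<in> (\<lambda>w. {v, w}) ` nbrs E v" by (auto simp: nbrs_def insert_commute)
    qed (auto simp: nbrs_def)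
  qed
  then show ?thesis by (simp add: bij_betw_same_card)
qed

lemma sum_card_nbrs:
  assumes "finite V" "\<forall>e\<in>E. e \<subseteq> V \<and> card e = 2"
  shows "(\<Sum>v\<in>V. card (nbrs E v)) = 2 * card E"
proof -
  have "finite E" using assms by (intro finite_subset[of E "Pow V"]) auto
  have "(\<Sum>v\<in>V. card {e \<in> E. v \<in> e}) = 2 * card E"
  proof (rule sum_multicount[OF assms(1) \<open>finite E\<close>], intro ballI)
    fix e assume "e \<in> E"
    then have "{v \<in> V. v \<in> e} = e" "card e = 2" using assms by auto
    then show "card {v \<in> V. v \<in> e} = 2" by simp
  qed
  then show ?thesis using assms by (simp add: card_incident_edges)
qed

text \<open>The edge \<open>{u, z}\<close> disappears, and for each common neighbour
  \<open>w\<close> the edges \<open>{u, w}\<close> and \<open>{z, w}\<close> become one.\<close>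

lemma card_contract:
  assumes "finite E" and two: "\<forall>e\<in>E. card e = 2" and uz: "{u, z} \<in> E"
    and fin: "finite (nbrs E z)"
  shows "card E = card (contract E u z) + 1 + card (nbrs E u \<inter> nbrs E z)"
proof -
  let ?new = "(\<lambda>w. {u, w}) ` (nbrs E z - {u} - nbrs E u)"
  have u_neq_z: "u \<noteq> z" using two uz by fastforce
  have u: "u \<in> nbrs E z" "u \<notin> nbrs E u" using uz two by (auto simp: nbrs_def insert_commute)
  have "contract E u z = {e \<in> E. z \<notin> e} \<union> ?new"
    using u_neq_z two by (auto simp: contract_def nbrs_def)
  moreover have "{e \<in> E. z \<notin> e} \<inter> ?new = {}" by (auto simp: nbrs_def)
  ultimately have "card (contract E u z) = card {e \<in> E. z \<notin> e} + card ?new"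
    using assms by (simp add: card_Un_disjoint)
  also have "card ?new = card (nbrs E z - {u} - nbrs E u)"
    by (intro card_image) (auto simp: inj_on_def doubleton_eq_iff)
  finally have 1: "card (contract E u z) = card {e \<in> E. z \<notin> e} + card (nbrs E z - {u} - nbrs E u)" .
  have "E = {e \<in> E. z \<notin> e} \<union> {e \<in> E. z \<in> e}" by auto
  then have "card E = card {e \<in> E. z \<notin> e} + card {e \<in> E. z \<in> e}"
    using assms by (subst (1) \<open>E = _\<close>, subst card_Un_disjoint) auto
  then have 2: "card E = card {e \<in> E. z \<notin> e} + card (nbrs E z)"
    using two by (simp add: card_incident_edges)
  have "nbrs E z = insert u ((nbrs E z - {u} - nbrs E u) \<union> (nbrs E u \<inter> nbrs E z))"
    using u by auto
  then have "card (nbrs E z) = Suc (card ((nbrs E z - {u} - nbrs E u) \<union> (nbrs E u \<inter> nbrs E z)))"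
    using fin u by (subst \<open>nbrs E z = _\<close>, subst card_insert_disjoint) auto
  also have "card ((nbrs E z - {u} - nbrs E u) \<union> (nbrs E u \<inter> nbrs E z))
      = card (nbrs E z - {u} - nbrs E u) + card (nbrs E u \<inter> nbrs E z)"
    using fin by (intro card_Un_disjoint) auto
  finally show ?thesis using 1 2 by simp
qed

lemma not_weakly_planar_K5:
  assumes "weakly_planar E" and xs: "distinct xs" "length xs = 5"
    and adj: "\<And>i j. i < j \<Longrightarrow> j < 5 \<Longrightarrow> {xs ! i, xs ! j} \<in> E"
  shows False
proof -
  obtain p A where pA: "weak_drawing E p A" using assms(1) by (auto simp: weakly_planar_def)
  let ?e = "\<lambda>i j. {xs ! i, xs ! j}"
  have "\<exists>g. path g \<and> path_image g \<subseteq> A (?e i j) \<and> pathstart g = p (xs ! i) \<and> pathfinish g = p (xs ! j)"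
    if "i < j" "j < 5" for i j
  proof -
    have "path_connected (A (?e i j))" "p ` ?e i j \<subseteq> A (?e i j)"
      using pA adj[OF that] by (auto simp: weak_drawing_def)
    then show ?thesis by (auto simp: path_connected_def)
  qed
  then obtain g where g: "\<And>i j. i < j \<Longrightarrow> j < 5 \<Longrightarrow> path (g i j) \<and> path_image (g i j) \<subseteq> A (?e i j)
      \<and> pathstart (g i j) = p (xs ! i) \<and> pathfinish (g i j) = p (xs ! j)"
    by metis
  show False
  proof (rule K5_paths_meet[where p = "\<lambda>i. p (xs ! i)" and g = g])
    fix i j k l :: nat assume ij: "i < j" "j < 5" and kl: "k < l" "l < 5" and "{i, j} \<inter> {k, l} = {}"
    then have "?e i j \<inter> ?e k l = {}" using xs by (auto simp: nth_eq_iff_index_eq)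
    then have "A (?e i j) \<inter> A (?e k l) = {}"
      using pA adj[OF ij] adj[OF kl] by (simp add: weak_drawing_def)
    then show "path_image (g i j) \<inter> path_image (g k l) = {}" using g[OF ij] g[OF kl] by blast
  qed (use g in auto)
qed

lemma not_weakly_planar_complete:
  assumes "weakly_planar E" "card S = 5" and adj: "\<And>x y. x \<in> S \<Longrightarrow> y \<in> S \<Longrightarrow> x \<noteq> y \<Longrightarrow> {x, y} \<in> E"
  shows False
proof -
  have "finite S" using assms(2) by (metis card.infinite zero_neq_numeral)
  then obtain xs where xs: "set xs = S" "distinct xs" using finite_distinct_list by blast
  then have len: "length xs = 5" using assms(2) distinct_card by fastforce
  show False
  proof (rule not_weakly_planar_K5[OF assms(1) xs(2) len])
    fix i j :: nat assume "i < j" "j < 5"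
    then show "{xs ! i, xs ! j} \<in> E"
      using xs len by (intro adj) (auto simp: nth_eq_iff_index_eq)
  qed
qed

text \<open>Mader's argument: in a minimal counterexample every edge lies in three triangles, so the
  neighbourhood of a vertex of degree at most 5 yields a \<open>K\<^sub>5\<close>, after contracting one edge if the
  degree is 5 and the neighbourhood is not complete.\<close>

lemma weakly_planar_card_edges_le:
  assumes "finite V" "\<forall>e\<in>E. e \<subseteq> V \<and> card e = 2" "weakly_planar E" "3 \<le> card V"
  shows "card E + 6 \<le> 3 * card V"
  using assms
proof (induction "card V" arbitrary: V E rule: less_induct)
  case less
  show ?case
  proof (rule ccontr)
    assume large: "\<not> ?thesis"
    have "finite E" using less.prems by (intro finite_subset[of E "Pow V"]) auto
    have "card V \<noteq> 3"
    proof
      assume 3: "card V = 3"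
      have "card E \<le> card {e. e \<subseteq> V \<and> card e = 2}"
        using less.prems by (intro card_mono) auto
      also have "\<dots> = 3" using less.prems(1) 3 by (simp add: n_subsets numeral_eq_Suc)
      finally show False using large 3 by simp
    qed
    then have V4: "4 \<le> card V" using less.prems by simp
    \<comment> \<open>Trimming to exactly one edge too many keeps the degree sum at
      \<open>6 * card V - 10\<close>, which is what forces a vertex of degree at most 5.\<close>
    have "3 * card V - 5 \<le> card E" using large by simp
    then obtain D where D: "D \<subseteq> E" "card D = 3 * card V - 5" "finite D"
      by (rule obtain_subset_with_card_n)
    have cardD: "card D + 5 = 3 * card V" using D V4 by simp
    have wp: "weakly_planar D" using less.prems(3) D(1) by (rule weakly_planar_mono)
    have DV: "\<forall>e\<in>D. e \<subseteq> V \<and> card e = 2" using less.prems(2) D(1) by auto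
    then have two: "\<forall>e\<in>D. card e = 2" by auto
    have nbrs_V: "nbrs D v \<subseteq> V" for v using DV by (auto simp: nbrs_def)
    then have fin_nbrs: "finite (nbrs D v)" for v using less.prems(1) finite_subset by blast
    \<comment> \<open>One vertex less lowers the bound by 3, and \<open>D\<close> exceeds it by 1.
      So deleting a vertex or contracting an edge must destroy at least 4 edges, which gives degree
      at least 4 and at least 3 common neighbours.\<close>
    have smaller: "card C + 6 \<le> 3 * (card V - 1)"
      if "z \<in> V" "\<forall>e\<in>C. e \<subseteq> V - {z} \<and> card e = 2" "weakly_planar C" for z C
      using less.hyps[of "V - {z}" C] that less.prems(1) V4 by simp
    have deg_ge: "4 \<le> card (nbrs D z)" if "z \<in> V" for z
    proof -
      let ?C = "{e \<in> D. z \<notin> e}"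
      have "card ?C + 6 \<le> 3 * (card V - 1)"
        using that DV wp by (intro smaller) (auto intro: weakly_planar_mono)
      moreover have "card D = card ?C + card {e \<in> D. z \<in> e}"
        using D(3) by (subst card_Un_disjoint[symmetric]) (auto intro!: arg_cong[of _ _ card])
      ultimately show ?thesis using cardD V4 card_incident_edges[OF two, of z] by simp
    qed
    have common: "3 \<le> card (nbrs D u \<inter> nbrs D z)" if "{u, z} \<in> D" for u z
    proof -
      have "u \<noteq> z" "u \<in> V" "z \<in> V" using that DV by fastforce+
      moreover have "e \<subseteq> V - {z} \<and> card e = 2" if "e \<in> contract D u z" for e
      proof (cases "e \<in> D \<and> z \<notin> e")
        case True
        then show ?thesis using DV by auto
      next
        case False
        then obtain w where w: "e = {u, w}" "w \<in> nbrs D z" "w \<noteq> u"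
          using \<open>e \<in> contract D u z\<close> by (auto simp: contract_def)
        then have "w \<in> V" "w \<noteq> z" using nbrs_V nbrs_neq[OF two] by auto
        then show ?thesis using w \<open>u \<noteq> z\<close> \<open>u \<in> V\<close> by auto
      qed
      ultimately have "card (contract D u z) + 6 \<le> 3 * (card V - 1)"
        using weakly_planar_contract[OF wp two that] by (intro smaller[of z]) auto
      then show ?thesis using card_contract[OF D(3) two that fin_nbrs] cardD V4 by simp
    qed
    obtain v where v: "v \<in> V" "card (nbrs D v) \<le> 5"
    proof (rule ccontr)
      assume "\<not> thesis"
      have "6 \<le> card (nbrs D v)" if "v \<in> V" for v
      proof -
        have "\<not> card (nbrs D v) \<le> 5" using \<open>\<And>v. v \<in> V \<Longrightarrow> card (nbrs D v) \<le> 5 \<Longrightarrow> thesis\<close> \<open>\<not> thesis\<close> \<open>v \<in> V\<close> by blast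
        then show ?thesis by simp
      qed
      then have "(\<Sum>v\<in>V. 6) \<le> (\<Sum>v\<in>V. card (nbrs D v))" by (intro sum_mono)
      then show False using sum_card_nbrs[OF less.prems(1) DV] cardD by simp
    qed
    define N where "N = nbrs D v"
    have finN: "finite N" and v_notin: "v \<notin> N"
      using fin_nbrs nbrs_neq[OF two] by (auto simp: N_def)
    have vN: "{v, x} \<in> D" "{x, v} \<in> D" if "x \<in> N" for x
      using that by (auto simp: N_def nbrs_def insert_commute)
    have common_N: "3 \<le> card (nbrs D x \<inter> N)" if "x \<in> N" for x
      using common[OF vN(2)[OF that]] by (simp add: N_def)
    have "card N = 4 \<or> card N = 5" using deg_ge[OF v(1)] v(2) by (auto simp: N_def)
    then show False
    proof
      assume 4: "card N = 4"
      have adj: "{x, y} \<in> D" if "x \<in> N" "y \<in> N" "x \<noteq> y" for x y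
      proof (rule ccontr)
        assume "{x, y} \<notin> D"
        then have "nbrs D x \<inter> N \<subseteq> N - {x, y}" using nbrs_neq[OF two] by (auto simp: nbrs_def)
        then have "card (nbrs D x \<inter> N) \<le> card (N - {x, y})" using finN by (intro card_mono) auto
        then show False using common_N[OF that(1)] that 4 finN by (simp add: card_Diff_subset)
      qed
      show False
        by (rule not_weakly_planar_complete[OF wp, of "insert v N"])
          (use 4 finN v_notin vN adj in auto)
    next
      assume 5: "card N = 5"
      \<comment> \<open>Three of the four other members of \<open>N\<close> are neighbours of
        \<open>x\<close>, so the pairs missing inside \<open>N\<close> form a matching.\<close>
      have adj: "{x, y} \<in> D"
        if "x \<in> N" "y \<in> N" "w \<in> N" "x \<noteq> y" "x \<noteq> w" "y \<noteq> w" "{x, w} \<notin> D" for x y w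
      proof (rule ccontr)
        assume "{x, y} \<notin> D"
        then have "nbrs D x \<inter> N \<subseteq> N - {x, y, w}" using nbrs_neq[OF two] that by (auto simp: nbrs_def)
        then have "card (nbrs D x \<inter> N) \<le> card (N - {x, y, w})" using finN by (intro card_mono) auto
        then show False using common_N[OF that(1)] that 5 finN by (simp add: card_Diff_subset)
      qed
      obtain x y where xy: "x \<in> N" "y \<in> N" "x \<noteq> y" "{x, y} \<notin> D"
        using not_weakly_planar_complete[OF wp 5] by blast
      then have "{y, x} \<notin> D" by (simp add: insert_commute)
      have "card (N - {x, y}) = 3" using xy 5 finN by (simp add: card_Diff_subset)
      then obtain a b c where abc: "N - {x, y} = {a, b, c}" "a \<noteq> b" "a \<noteq> c" "b \<noteq> c"
        by (auto simp: card_3_iff)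
      then have abc_N: "a \<in> N" "b \<in> N" "c \<in> N" by blast+
      \<comment> \<open>At most one pair among \<open>a\<close>, \<open>b\<close>, \<open>c\<close>
        is missing, so some \<open>t\<close> is adjacent to both others; a missing pair can only be
        \<open>{z, w}\<close>.\<close>
      obtain z w t where zwt: "{z, w, t} = {a, b, c}" "z \<noteq> w" "z \<noteq> t" "w \<noteq> t" "{t, z} \<in> D" "{t, w} \<in> D"
      proof (cases "{a, b} \<in> D")
        case ab: True
        then have ba: "{b, a} \<in> D" by (simp add: insert_commute)
        show ?thesis
        proof (cases "{a, c} \<in> D")
          case True
          then show ?thesis using that[of b c a] ab abc by auto
        next
          case False
          then have "{c, a} \<notin> D" by (simp add: insert_commute)
          then have "{c, b} \<in> D" using adj[of c b a] abc abc_N by auto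
          then have "{b, c} \<in> D" by (simp add: insert_commute)
          then show ?thesis using that[of a c b] ba abc by auto
        qed
      next
        case False
        moreover from this have "{b, a} \<notin> D" by (simp add: insert_commute)
        ultimately have "{a, c} \<in> D" "{b, c} \<in> D" using adj[of a c b] adj[of b c a] abc abc_N by auto
        then have "{c, a} \<in> D" "{c, b} \<in> D" by (simp_all add: insert_commute)
        then show ?thesis using that[of a b c] abc by auto
      qed
      have mem: "z \<in> N" "w \<in> N" "t \<in> N" "z \<notin> {x, y}" "w \<notin> {x, y}" "t \<notin> {x, y}"
        using zwt(1) abc(1) by blast+
      have xyD: "{x, q} \<in> D" "{y, q} \<in> D" "{q, x} \<in> D" "{q, y} \<in> D" if "q \<in> {z, w, t}" for q
        using adj[of x q y] adj[of y q x] xy mem that \<open>{y, x} \<notin> D\<close> by (auto simp: insert_commute)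
      \<comment> \<open>Contracting \<open>z\<close> into \<open>x\<close> repairs the missing pair
        \<open>{x, y}\<close>, because \<open>z\<close> is adjacent to \<open>y\<close>, and removes
        \<open>z\<close> together with the possibly missing pair \<open>{z, w}\<close>.\<close>
      show False
      proof (rule not_weakly_planar_complete[OF weakly_planar_contract[OF wp two]])
        show "{x, z} \<in> D" using xyD by simp
        have "v \<notin> {t, w, x, y}" using mem xy v_notin by blast
        moreover have "t \<notin> {w, x, y}" "w \<notin> {x, y}" using mem zwt(4) by auto
        ultimately show "card {v, t, w, x, y} = 5" using xy(3) by simp
        fix q r assume "q \<in> {v, t, w, x, y}" "r \<in> {v, t, w, x, y}" "q \<noteq> r"
        moreover have "{x, y} \<in> contract D x z" "{y, x} \<in> contract D x z"
          using xyD[of z] xy(3) by (auto simp: contract_def nbrs_def insert_commute)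
        moreover have "{q, r} \<in> contract D x z" if "{q, r} \<in> D" "q \<noteq> z" "r \<noteq> z" for q r
          using that by (auto simp: contract_def)
        moreover have "z \<notin> {v, t, w, x, y}" using mem zwt v_notin by auto
        moreover have "{w, t} \<in> D" using zwt(6) by (simp add: insert_commute)
        ultimately show "{q, r} \<in> contract D x z"
          using xyD vN mem xy zwt(6) by (elim insertE emptyE) auto
      qed
    qed
  qed
qed

lemma planar_card_edges_le:
  assumes "simple_graph G" "planar G" "3 \<le> card (verts G)"
  shows "card (edges G) \<le> 3 * card (verts G) - 6"
  using weakly_planar_card_edges_le[of "verts G" "edges G"] planar_imp_weakly_planar[of G] assms
  by (auto simp: simple_graph_def)

section \<open>Straight-line drawings grown vertex by vertex\<close>

text \<open>\<open>N j\<close> is meant to consist of earlier vertices. Recording the graph in order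
  of construction assigns each edge to its later end, so edges can be counted and drawn one vertex
  at a time.\<close>

definition back_graph :: "(nat \<Rightarrow> nat set) \<Rightarrow> nat \<Rightarrow> nat ugraph" where
  "back_graph N n = Graph {..<n} {{j, b} | j b. j < n \<and> b \<in> N j}"

lemma verts_back_graph [simp]: "verts (back_graph N n) = {..<n}"
  by (simp add: back_graph_def)

lemma simple_back_graph: "(\<And>j. j < n \<Longrightarrow> N j \<subseteq> {..<j}) \<Longrightarrow> simple_graph (back_graph N n)"
  by (fastforce simp: simple_graph_def back_graph_def card_2_iff)

lemma edge_back_graph_iff:
  assumes "\<And>j. j < n \<Longrightarrow> N j \<subseteq> {..<j}" "i < j"
  shows "{i, j} \<in> edges (back_graph N n) \<longleftrightarrow> j < n \<and> i \<in> N j"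
  using assms by (fastforce simp: back_graph_def doubleton_eq_iff)

lemma card_edges_back_graph:
  assumes "\<And>j. j < n \<Longrightarrow> N j \<subseteq> {..<j}"
  shows "card (edges (back_graph N n)) = (\<Sum>j<n. card (N j))"
proof -
  have "edges (back_graph N n) = (\<Union>j<n. (\<lambda>b. {j, b}) ` N j)"
    by (auto simp: back_graph_def)
  also have "card \<dots> = (\<Sum>j<n. card ((\<lambda>b. {j, b}) ` N j))"
  proof (rule card_UN_disjoint)
    show "\<forall>j\<in>{..<n}. finite ((\<lambda>b. {j, b}) ` N j)"
      using assms by (meson finite_imageI finite_lessThan finite_subset lessThan_iff)
    show "\<forall>i\<in>{..<n}. \<forall>j\<in>{..<n}. i \<noteq> j \<longrightarrow> (\<lambda>b. {i, b}) ` N i \<inter> (\<lambda>b. {j, b}) ` N j = {}"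
    proof (intro ballI impI equals0I)
      fix i j e assume "i \<in> {..<n}" "j \<in> {..<n}" "i \<noteq> j"
        and e: "e \<in> (\<lambda>b. {i, b}) ` N i \<inter> (\<lambda>b. {j, b}) ` N j"
      then have "N i \<subseteq> {..<i}" "N j \<subseteq> {..<j}" using assms by auto
      with e \<open>i \<noteq> j\<close> show False by (auto simp: doubleton_eq_iff dest!: subsetD)
    qed
  qed simp
  also have "\<dots> = (\<Sum>j<n. card (N j))"
    by (intro sum.cong refl card_image) (auto simp: inj_on_def doubleton_eq_iff)
  finally show ?thesis .
qed

text \<open>The determinant of two plane vectors, zero exactly when they are linearly
  dependent.\<close>

definition cross :: "complex \<Rightarrow> complex \<Rightarrow> real" where
  "cross u v = Re u * Im v - Im u * Re v"

lemma closed_segments_Int_common_end: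
  fixes x y z :: complex
  assumes nz: "cross (y - x) (z - x) \<noteq> 0"
  shows "closed_segment x y \<inter> closed_segment x z \<subseteq> {x}"
proof
  fix q assume "q \<in> closed_segment x y \<inter> closed_segment x z"
  then obtain s t where s: "q = (1 - s) *\<^sub>R x + s *\<^sub>R y" and t: "q = (1 - t) *\<^sub>R x + t *\<^sub>R z"
    unfolding in_segment Int_iff by blast
  have s': "q - x = s *\<^sub>R (y - x)" using s by (simp add: algebra_simps)
  have t': "q - x = t *\<^sub>R (z - x)" using t by (simp add: algebra_simps)
  have "s * cross (y - x) (z - x) = cross (q - x) (z - x)"
    unfolding s' by (simp add: cross_def algebra_simps)
  also have "\<dots> = 0" unfolding t' by (simp add: cross_def)
  finally have "s = 0" using nz by simp
  then show "q \<in> {x}" using s by simp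
qed

text \<open>The functional \<open>a\<close> says that \<open>p b\<close> is visible from \<open>p j\<close> past the convex hull of everything drawn so far.\<close>

lemma planar_back_graph:
  fixes p :: "nat \<Rightarrow> complex"
  assumes N: "\<And>j. j < n \<Longrightarrow> N j \<subseteq> {..<j}"
    and ne: "\<And>j. j < n \<Longrightarrow> 0 < j \<Longrightarrow> N j \<noteq> {}"
    and visible: "\<And>j b. j < n \<Longrightarrow> b \<in> N j \<Longrightarrow>
      \<exists>a. (\<forall>i<j. a \<bullet> p i \<le> a \<bullet> p b) \<and> a \<bullet> p b < a \<bullet> p j"
    and general: "\<And>j b c. j < n \<Longrightarrow> b \<in> N j \<Longrightarrow> c \<in> N j \<Longrightarrow> b < c \<Longrightarrow>
      cross (p b - p j) (p c - p j) \<noteq> 0"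
  shows "planar (back_graph N n)"
proof -
  let ?H = "\<lambda>j. convex hull (p ` {..<j})"
  let ?seg = "\<lambda>e. convex hull (p ` e)"
  have seg: "?seg {j, b} = closed_segment (p j) (p b)" for j b
    by (simp add: segment_convex_hull)
  have hull: "a \<bullet> q \<le> c" if "\<And>i. i < j \<Longrightarrow> a \<bullet> p i \<le> c" "q \<in> ?H j" for a q c j
  proof -
    have "?H j \<subseteq> {x. a \<bullet> x \<le> c}"
      using that(1) by (intro hull_minimal convex_halfspace_le) auto
    then show ?thesis using that(2) by auto
  qed
  \<comment> \<open>Along the segment from \<open>p b\<close> to \<open>p j\<close> the functional
    strictly increases from its maximum over the earlier hull, so the segment leaves the hull at
    once.\<close>
  have touch: "q = p b" if j: "j < n" "b \<in> N j" and q: "q \<in> ?seg {j, b}" "q \<in> ?H j" for q j b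
  proof -
    obtain a where a: "\<forall>i<j. a \<bullet> p i \<le> a \<bullet> p b" "a \<bullet> p b < a \<bullet> p j"
      using visible[OF j] by blast
    have "q \<in> closed_segment (p b) (p j)" using q(1) unfolding seg by (simp only: closed_segment_commute[of "p j" "p b"])
    then obtain t where t: "0 \<le> t" "t \<le> 1" "q = (1 - t) *\<^sub>R p b + t *\<^sub>R p j"
      by (auto simp: in_segment)
    have "a \<bullet> q \<le> a \<bullet> p b" using hull[of j a "a \<bullet> p b" q] a q(2) by simp
    moreover have "a \<bullet> q = a \<bullet> p b + t * (a \<bullet> p j - a \<bullet> p b)"
      unfolding t by (simp add: inner_add_right algebra_simps)
    ultimately have "t * (a \<bullet> p j - a \<bullet> p b) \<le> 0" by simp
    then have "t = 0" using a(2) t(1) by (simp add: mult_le_0_iff)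
    then show ?thesis using t by simp
  qed
  have new: "p j \<notin> ?H j" if j: "j < n" for j
  proof (cases "j = 0")
    case False
    then obtain b where b: "b \<in> N j" using ne j by blast
    then obtain a where a: "a \<bullet> p b < a \<bullet> p j" using visible j by blast
    show ?thesis
    proof
      assume "p j \<in> ?H j"
      then have "p j = p b" using touch[OF j b, of "p j"] by (simp add: hull_inc)
      then show False using a by simp
    qed
  qed simp
  have neq: "p i \<noteq> p j" if "i < j" "j < n" for i j
    using new[of j] that by (metis hull_inc imageI lessThan_iff)
  have inj: "inj_on p {..<n}"
    by (rule linorder_inj_onI) (use neq in auto)
  have seg_H: "?seg {i, b} \<subseteq> ?H j" if "i < j" "j < n" "b \<in> N i" for i j b
  proof -
    have "b < i" using N[of i] that by auto
    then show ?thesis using that by (intro hull_mono image_mono) auto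
  qed
  have edgeE: "\<exists>j b. e = {j, b} \<and> j < n \<and> b \<in> N j \<and> b < j" if "e \<in> edges (back_graph N n)" for e
    using that N by (fastforce simp: back_graph_def)
  have vertex: "?seg {j, b} \<inter> p ` {..<n} = p ` {j, b}" if "j < n" "b \<in> N j" for j b
  proof (intro equalityI subsetI)
    fix q assume q: "q \<in> ?seg {j, b} \<inter> p ` {..<n}"
    then obtain v where v: "v < n" "q = p v" by auto
    consider "v < j" | "v = j" | "v > j" by linarith
    then show "q \<in> p ` {j, b}"
    proof cases
      case 1
      then have "p v \<in> ?H j" by (simp add: hull_inc)
      then have "q = p b" using touch[OF that, of q] q unfolding v(2) by blast
      then show ?thesis by simp
    next
      case 3
      then have "?seg {j, b} \<subseteq> ?H v" using seg_H v(1) that(2) by simp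
      then have "q \<in> ?H v" using IntD1[OF q] by (rule subsetD)
      then show ?thesis using new[OF v(1)] unfolding v(2) by contradiction
    qed (use v in auto)
  next
    fix q assume "q \<in> p ` {j, b}"
    moreover have "{j, b} \<subseteq> {..<n}" using N[OF that(1)] that by auto
    ultimately show "q \<in> ?seg {j, b} \<inter> p ` {..<n}"
      using hull_subset[of "p ` {j, b}" convex] by blast
  qed
  \<comment> \<open>The older segment lies in the hull before \<open>j\<close>, so a common point
    can only be \<open>p b\<close>; a vertex on the older segment is one of its ends.\<close>
  have later: "?seg {j, b} \<inter> ?seg {i, c} \<subseteq> p ` ({j, b} \<inter> {i, c})"
    if "i < j" "j < n" "b \<in> N j" "c \<in> N i" for i j b c
  proof
    fix q assume q: "q \<in> ?seg {j, b} \<inter> ?seg {i, c}"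
    then have q1: "q \<in> ?seg {j, b}" and q2: "q \<in> ?seg {i, c}" by (rule IntD1, rule IntD2)
    have "q \<in> ?H j" using seg_H[OF that(1,2,4)] q2 by (rule subsetD)
    with q1 have qb: "q = p b" by (rule touch[OF that(2,3)])
    have "b < n" "c < n" using N[of j] N[of i] that by auto
    then have "p b \<in> ?seg {i, c} \<inter> p ` {..<n}" using q2 unfolding qb by simp
    moreover have "i < n" using that by simp
    ultimately have "p b \<in> p ` {i, c}" by (simp only: vertex[OF _ that(4)])
    then have "b = i \<or> b = c" using inj \<open>b < n\<close> \<open>c < n\<close> \<open>i < n\<close> by (auto dest: inj_onD)
    then show "q \<in> p ` ({j, b} \<inter> {i, c})" using qb by blast
  qed
  have same: "?seg {j, b} \<inter> ?seg {j, c} \<subseteq> p ` ({j, b} \<inter> {j, c})"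
    if "j < n" "b \<in> N j" "c \<in> N j" "b \<noteq> c" for j b c
  proof -
    have "cross (p b - p j) (p c - p j) \<noteq> 0"
      using general[of j b c] general[of j c b] that
      by (cases b c rule: linorder_cases) (auto simp: cross_def mult.commute)
    then have "?seg {j, b} \<inter> ?seg {j, c} \<subseteq> {p j}"
      unfolding seg by (rule closed_segments_Int_common_end)
    then show ?thesis by (rule order_trans) simp
  qed
  have meet: "?seg e \<inter> ?seg e' = p ` (e \<inter> e')"
    if e1: "e \<in> edges (back_graph N n)" and e2: "e' \<in> edges (back_graph N n)" and "e \<noteq> e'"
    for e e'
  proof
    obtain j b where e: "e = {j, b}" "j < n" "b \<in> N j" using edgeE[OF e1] by blast
    obtain i c where e': "e' = {i, c}" "i < n" "c \<in> N i" using edgeE[OF e2] by blast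
    consider "i < j" | "i = j" | "j < i" by linarith
    then show "?seg e \<inter> ?seg e' \<subseteq> p ` (e \<inter> e')"
    proof cases
      case 1
      then show ?thesis using later[of i j b c] e e' by simp
    next
      case 2
      then have "b \<noteq> c" using e e' \<open>e \<noteq> e'\<close> by blast
      then show ?thesis using same[of j b c] e e' 2 by simp
    next
      case 3
      then show ?thesis using later[of j i c b] e e' by (simp add: Int_commute)
    qed
  next
    show "p ` (e \<inter> e') \<subseteq> ?seg e \<inter> ?seg e'"
      using hull_subset[of "p ` e" convex] hull_subset[of "p ` e'" convex] by blast
  qed
  \<comment> \<open>Edges are unordered sets, so each arc needs a canonical direction: from the
    later end to the earlier.\<close>
  let ?c = "\<lambda>e. linepath (p (Max e)) (p (Min e))"
  have path: "path_image (?c e) = ?seg e \<and> arc (?c e) \<and> {pathstart (?c e), pathfinish (?c e)} = p ` e"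
    if "e \<in> edges (back_graph N n)" for e
  proof -
    from edgeE[OF that] obtain j b where e: "e = {j, b}" "j < n" "b < j" by blast
    then have "Max e = j" "Min e = b" by auto
    then show ?thesis using e neq[of b j] by (simp add: segment_convex_hull arc_linepath)
  qed
  have "plane_drawing (back_graph N n) p ?c"
    unfolding plane_drawing_def verts_back_graph
  proof (intro conjI ballI impI inj)
    fix e assume e: "e \<in> edges (back_graph N n)"
    show "path_image (?c e) \<inter> p ` {..<n} = p ` e" using path[OF e] edgeE[OF e] vertex by blast
    show "path_image (?c e) \<inter> path_image (?c e') = p ` (e \<inter> e')"
      if "e' \<in> edges (back_graph N n)" "e \<noteq> e'" for e'
      using path[OF e] path[OF that(1)] meet[OF e that] by simp
  qed (use path in auto)
  then show ?thesis by (auto simp: planar_def)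
qed

section \<open>The cube of a path and the double wheel\<close>

definition cube_nbrs :: "nat \<Rightarrow> nat set" where
  "cube_nbrs j = {i. i < j \<and> j \<le> i + 3}"

definition path_cube :: "nat \<Rightarrow> nat ugraph" where
  "path_cube n = back_graph cube_nbrs n"

text \<open>The vertices of the cube of a path spiral outwards along three rays.\<close>

definition ray :: "nat \<Rightarrow> complex" where
  "ray m = (if m = 0 then Complex 1 0 else if m = 1 then Complex 0 1 else Complex (-1) (-1))"

text \<open>Any two rays are linearly independent and all three sum to zero: two values may be
  prescribed, and the third is forced.\<close>

lemma ray_functional:
  assumes "m < 3" "m' < 3" "m \<noteq> m'"
  shows "\<exists>a. a \<bullet> ray m = r \<and> a \<bullet> ray m' = s \<and>
    (\<forall>l<3. l \<noteq> m \<longrightarrow> l \<noteq> m' \<longrightarrow> a \<bullet> ray l = - (r + s))"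
proof -
  have "m \<in> {0, 1, 2}" "m' \<in> {0, 1, 2}" using assms by auto
  then consider "m = 0" "m' = 1" | "m = 1" "m' = 0" | "m = 0" "m' = 2" | "m = 2" "m' = 0"
    | "m = 1" "m' = 2" | "m = 2" "m' = 1"
    using assms(3) by auto
  then show ?thesis
  proof cases
    case 1 then show ?thesis
      by (intro exI[of _ "Complex r s"]) (auto simp: ray_def inner_complex_def)
  next
    case 2 then show ?thesis
      by (intro exI[of _ "Complex s r"]) (auto simp: ray_def inner_complex_def)
  next
    case 3 then show ?thesis
      by (intro exI[of _ "Complex r (- r - s)"]) (auto simp: ray_def inner_complex_def)
  next
    case 4 then show ?thesis
      by (intro exI[of _ "Complex s (- r - s)"]) (auto simp: ray_def inner_complex_def)
  next
    case 5 then show ?thesis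
      by (intro exI[of _ "Complex (- r - s) r"]) (auto simp: ray_def inner_complex_def)
  next
    case 6 then show ?thesis
      by (intro exI[of _ "Complex (- r - s) s"]) (auto simp: ray_def inner_complex_def)
  qed
qed

lemma mod_3_neq:
  fixes i j :: nat
  assumes "i < j" "j < i + 3"
  shows "i mod 3 \<noteq> j mod 3"
proof
  assume "i mod 3 = j mod 3"
  then have "3 dvd j - i" using assms mod_eq_dvd_iff_nat[of i j 3] by simp
  then have "3 \<le> j - i" using assms by (intro dvd_imp_le) simp_all
  then show False using assms by simp
qed

text \<open>With the offset 3 in the radii, vertex \<open>j - 3\<close> has radius \<open>j\<close>.
  The functional takes the value \<open>j * (c + 3)\<close> both there and at \<open>p c\<close>, so
  its level line carries a side of the triangle of outermost points (for \<open>j < 3\<close>, the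
  point of radius \<open>j\<close> on the ray of \<open>j\<close> stands in), and \<open>p j\<close>
  lies beyond it.\<close>

lemma cube_visible:
  fixes j b :: nat
  defines "p \<equiv> \<lambda>i. real (i + 3) *\<^sub>R ray (i mod 3)"
  assumes b: "b \<in> cube_nbrs j"
  shows "\<exists>a. (\<forall>i<j. a \<bullet> p i \<le> a \<bullet> p b) \<and> a \<bullet> p b < a \<bullet> p j"
proof -
  \<comment> \<open>The side through \<open>p (j - 3)\<close> and \<open>p (j - 1)\<close> serves
    both of these vertices; only \<open>b = j - 2\<close> needs the other side.\<close>
  define c where "c = (if b + 2 = j then b else j - 1)"
  have c: "c = b \<or> j = b + 3" "c < j" "j \<le> c + 2" using b by (auto simp: cube_nbrs_def c_def)
  have cj: "c mod 3 \<noteq> j mod 3" using c(2,3) by (intro mod_3_neq) simp_all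
  obtain a where a: "a \<bullet> ray (j mod 3) = real (c + 3)" "a \<bullet> ray (c mod 3) = real j"
    "\<forall>l<3. l \<noteq> j mod 3 \<longrightarrow> l \<noteq> c mod 3 \<longrightarrow> a \<bullet> ray l = - (real (c + 3) + real j)"
    using ray_functional[of "j mod 3" "c mod 3" "real (c + 3)" "real j"] cj
    by (metis mod_less_divisor zero_less_numeral)
  have ab: "a \<bullet> p b = real j * real (c + 3)"
  proof (cases "c = b")
    case True
    then show ?thesis using a(2) by (simp add: p_def)
  next
    case False
    then have "j = b + 3" using c by simp
    then show ?thesis using a(1) by (simp add: p_def)
  qed
  have "a \<bullet> p i \<le> a \<bullet> p b" if "i < j" for i
  proof -
    consider "i mod 3 = j mod 3" | "i mod 3 = c mod 3" | "i mod 3 \<noteq> j mod 3" "i mod 3 \<noteq> c mod 3"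
      by blast
    then show ?thesis
    proof cases
      case 1
      then have "i + 3 \<le> j" using mod_3_neq[of i j] that by linarith
      then have "real (i + 3) * real (c + 3) \<le> real j * real (c + 3)"
        by (intro mult_right_mono) (simp_all only: of_nat_le_iff of_nat_0_le_iff)
      then show ?thesis using 1 a(1) unfolding ab by (simp add: p_def)
    next
      case 2
      then have "i \<le> c" using mod_3_neq[of c i] that c(3) by linarith
      then have "real (i + 3) * real j \<le> real (c + 3) * real j" by (intro mult_right_mono) simp_all
      then show ?thesis using 2 a(2) unfolding ab by (simp add: p_def mult.commute)
    next
      case 3
      then have "a \<bullet> ray (i mod 3) = - (real (c + 3) + real j)" using a(3) by simp
      then have "a \<bullet> p i = - (real (i + 3) * (real (c + 3) + real j))"
        by (simp only: p_def inner_scaleR_right mult_minus_right)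
      also have "\<dots> \<le> 0" by simp
      also have "0 \<le> a \<bullet> p b" unfolding ab by simp
      finally show ?thesis .
    qed
  qed
  moreover have "a \<bullet> p b < a \<bullet> p j" unfolding ab using a(1) by (simp add: p_def)
  ultimately show ?thesis by blast
qed

lemma cross_ray:
  assumes "i < 3" "j < 3"
  shows "cross (ray i) (ray j) =
    (if i = j then 0 else if (i, j) \<in> {(0, 1), (1, 2), (2, 0)} then 1 else - 1)"
proof -
  have "i \<in> {0, 1, 2}" "j \<in> {0, 1, 2}" using assms by auto
  then show ?thesis by (elim insertE emptyE) (simp_all add: cross_def ray_def)
qed

text \<open>Twice the signed area of a triangle with one corner on each ray. The origin cuts it into
  three triangles of the same orientation, whose areas cannot cancel.\<close>

lemma cross_rays:
  assumes lt: "m < 3" "m' < 3" "l < 3" and neq: "m \<noteq> m'" "m \<noteq> l" "m' \<noteq> l"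
    and pos: "0 < x" "0 < y" "0 < z"
  shows "cross (x *\<^sub>R ray m - z *\<^sub>R ray l) (y *\<^sub>R ray m' - z *\<^sub>R ray l) \<noteq> 0"
proof -
  have eq: "cross (x *\<^sub>R ray m - z *\<^sub>R ray l) (y *\<^sub>R ray m' - z *\<^sub>R ray l)
      = x * y * cross (ray m) (ray m') + y * z * cross (ray m') (ray l) + z * x * cross (ray l) (ray m)"
    by (simp add: cross_def algebra_simps)
  define s where "s = cross (ray m) (ray m')"
  have "{m, m', l} \<subseteq> {0, 1, 2}" using lt by auto
  then have "(m, m', l) \<in> {(0, 1, 2), (1, 2, 0), (2, 0, 1), (0, 2, 1), (1, 0, 2), (2, 1, 0)}"
    using neq by blast
  then have "cross (ray m') (ray l) = s \<and> cross (ray l) (ray m) = s \<and> s \<noteq> 0"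
    unfolding s_def by (elim insertE emptyE) (simp_all add: cross_ray)
  moreover from this have "cross (x *\<^sub>R ray m - z *\<^sub>R ray l) (y *\<^sub>R ray m' - z *\<^sub>R ray l)
      = (x * y + y * z + z * x) * s"
    unfolding eq s_def by (simp add: distrib_right)
  moreover have "0 < x * y + y * z + z * x"
    using pos by (intro add_pos_pos mult_pos_pos)
  ultimately show ?thesis by simp
qed

lemma cross_collinear_rays:
  assumes "m < 3" "m' < 3" "m \<noteq> m'" "x \<noteq> z" "0 < y"
  shows "cross (x *\<^sub>R ray m - z *\<^sub>R ray m) (y *\<^sub>R ray m' - z *\<^sub>R ray m) \<noteq> 0"
proof -
  have "cross (x *\<^sub>R ray m - z *\<^sub>R ray m) (y *\<^sub>R ray m' - z *\<^sub>R ray m)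
      = (x - z) * y * cross (ray m) (ray m')"
    by (simp add: cross_def algebra_simps)
  then show ?thesis using assms by (simp add: cross_ray)
qed

lemma cube_cross:
  fixes j b :: nat
  defines "p \<equiv> \<lambda>i. real (i + 3) *\<^sub>R ray (i mod 3)"
  assumes "b \<in> cube_nbrs j" "c \<in> cube_nbrs j" "b < c"
  shows "cross (p b - p j) (p c - p j) \<noteq> 0"
proof -
  have "b \<le> j" "c \<le> j" "j \<le> b + 3" using assms(2-4) by (simp_all add: cube_nbrs_def)
  then consider "c = b + 1" "j = b + 2" | "j = b + 3" "c = b + 1 \<or> c = b + 2"
    using assms(2-4) unfolding cube_nbrs_def mem_Collect_eq by linarith
  then show ?thesis
  proof cases
    case 1
    have "b mod 3 \<noteq> (b + 1) mod 3" "b mod 3 \<noteq> (b + 2) mod 3" "(b + 1) mod 3 \<noteq> (b + 2) mod 3"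
      by (intro mod_3_neq; simp)+
    then show ?thesis unfolding 1 p_def by (intro cross_rays) simp_all
  next
    case 2
    then have eq: "j mod 3 = b mod 3" and neq: "b mod 3 \<noteq> c mod 3"
      using mod_3_neq[of b c] by auto
    show ?thesis unfolding p_def eq by (intro cross_collinear_rays) (use neq 2(1) in simp_all)
  qed
qed

lemma cube_nbrs_subset: "cube_nbrs j \<subseteq> {..<j}"
  by (auto simp: cube_nbrs_def)

lemma planar_path_cube: "planar (path_cube n)"
  unfolding path_cube_def
proof (rule planar_back_graph[where p = "\<lambda>i. real (i + 3) *\<^sub>R ray (i mod 3)"])
  fix j :: nat assume "0 < j"
  then have "j - 1 \<in> cube_nbrs j" by (auto simp: cube_nbrs_def)
  then show "cube_nbrs j \<noteq> {}" by blast
qed (use cube_nbrs_subset cube_visible cube_cross in blast)+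

lemma card_edges_path_cube:
  assumes "3 \<le> n"
  shows "card (edges (path_cube n)) = 3 * n - 6"
proof -
  have card: "card (cube_nbrs j) = min j 3" for j
  proof -
    have "cube_nbrs j = {j - 3..<j}" by (auto simp: cube_nbrs_def)
    then show ?thesis by simp
  qed
  have "(\<Sum>j<n. card (cube_nbrs j)) = 3 * n - 6"
    using assms by (induction n rule: dec_induct) (auto simp: card numeral_eq_Suc)
  then show ?thesis by (simp add: path_cube_def card_edges_back_graph cube_nbrs_subset)
qed

text \<open>The hubs are \<open>0\<close> and \<open>k + 3\<close>; the rim is the cycle \<open>1, \<dots>, k, k + 2, k + 1\<close>.\<close>

definition wheel_nbrs :: "nat \<Rightarrow> nat \<Rightarrow> nat set" where
  "wheel_nbrs k j = (if j = 0 then {} else if j \<le> k then {0, j - 1} else if j = k + 1 then {0, 1}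
     else if j = k + 2 then {0, k, k + 1} else {1..k + 2})"

definition double_wheel :: "nat \<Rightarrow> nat ugraph" where
  "double_wheel k = back_graph (wheel_nbrs k) (k + 4)"

text \<open>The path \<open>1, \<dots>, k\<close> lies on the real axis above hub \<open>0\<close>.
  The points \<open>k + 1\<close> and \<open>k + 2\<close> are far out on either side and low enough
  to bury that hub inside the hull, which leaves the whole rim on the boundary, in view of the
  second hub on top.\<close>

definition wheel_point :: "nat \<Rightarrow> nat \<Rightarrow> complex" where
  "wheel_point k j = (if j = 0 then Complex 0 (-1) else if j \<le> k then Complex (real j) 0
     else if j = k + 1 then Complex (- real k - 1) (-2)
     else if j = k + 2 then Complex (2 * real k + 2) (-2) else Complex 0 2)"

lemma wheel_nbrs_eq:
  "1 \<le> j \<Longrightarrow> j \<le> k \<Longrightarrow> wheel_nbrs k j = {0, j - 1}"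
  "wheel_nbrs k (k + 1) = {0, 1}"
  "wheel_nbrs k (k + 2) = {0, k, k + 1}"
  "wheel_nbrs k (k + 3) = {1..k + 2}"
  by (simp_all add: wheel_nbrs_def)

lemma wheel_nbrs_subset: "2 \<le> k \<Longrightarrow> j < k + 4 \<Longrightarrow> wheel_nbrs k j \<subseteq> {..<j}"
  by (auto simp: wheel_nbrs_def)

text \<open>Each functional is normal to a supporting line of the earlier hull. In the order of the
  cases these pass through \<open>0\<close> and \<open>j - 1\<close> (vertical if
  \<open>j = 1\<close>), \<open>0\<close> and \<open>1\<close>, \<open>0\<close> and
  \<open>k\<close>, \<open>0\<close> and \<open>k + 1\<close>, then along the real axis, and finally
  through \<open>1\<close> and \<open>k + 1\<close>, and through \<open>k\<close> and
  \<open>k + 2\<close>.\<close>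

lemma wheel_visible:
  assumes k: "2 \<le> k" and j: "j < k + 4" and b: "b \<in> wheel_nbrs k j"
  shows "\<exists>a. (\<forall>i<j. a \<bullet> wheel_point k i \<le> a \<bullet> wheel_point k b)
           \<and> a \<bullet> wheel_point k b < a \<bullet> wheel_point k j"
proof -
  have "j \<noteq> 0" using b by (cases "j = 0") (simp_all add: wheel_nbrs_def)
  then have "1 \<le> j \<and> j \<le> k \<or> j = k + 1 \<or> j = k + 2 \<or> j = k + 3" using j by linarith
  then consider "1 \<le> j" "j \<le> k" "b = 0 \<or> b = j - 1" | "j = k + 1" "b = 0 \<or> b = 1"
    | "j = k + 2" "b = 0 \<or> b = k" | "j = k + 2" "b = k + 1"
    | "j = k + 3" "1 \<le> b" "b \<le> k" | "j = k + 3" "b = k + 1" | "j = k + 3" "b = k + 2"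
  proof (elim disjE conjE)
    assume "j = k + 3"
    then have "1 \<le> b" "b \<le> k + 2" using b wheel_nbrs_eq(4)[of k] by simp_all
    then have "1 \<le> b \<and> b \<le> k \<or> b = k + 1 \<or> b = k + 2" by linarith
    then show thesis using that(5-7) \<open>j = k + 3\<close> by blast
  qed (use b wheel_nbrs_eq that in auto)
  then show ?thesis
  proof cases
    case 1
    then show ?thesis
      by (intro exI[of _ "Complex 1 (1 - real j)"])
        (auto simp: wheel_point_def inner_complex_def of_nat_diff)
  next
    case 2
    then show ?thesis using k
      by (intro exI[of _ "Complex (-1) 1"]) (auto simp: wheel_point_def inner_complex_def)
  next
    case 3
    then show ?thesis using k
      by (intro exI[of _ "Complex 1 (- real k)"]) (auto simp: wheel_point_def inner_complex_def)
  next
    case 4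
    then show ?thesis using k
      by (intro exI[of _ "Complex 1 (- real k - 1)"])
        (auto simp: wheel_point_def inner_complex_def algebra_simps)
  next
    case 5
    then show ?thesis
      by (intro exI[of _ "Complex 0 1"]) (auto simp: wheel_point_def inner_complex_def)
  next
    case 6
    then show ?thesis using k
      by (intro exI[of _ "Complex (-2) (real k + 2)"])
        (auto simp: wheel_point_def inner_complex_def algebra_simps)
  next
    case 7
    then show ?thesis using k
      by (intro exI[of _ "Complex 2 (real k + 2)"])
        (auto simp: wheel_point_def inner_complex_def algebra_simps)
  qed
qed

lemma wheel_cross:
  fixes k j b c :: nat
  defines "p \<equiv> wheel_point k"
  assumes k: "2 \<le> k" and j: "j < k + 4" and bc: "b \<in> wheel_nbrs k j" "c \<in> wheel_nbrs k j" "b < c"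
  shows "cross (p b - p j) (p c - p j) \<noteq> 0"
proof -
  have "j \<noteq> 0" using bc by (cases "j = 0") (simp_all add: wheel_nbrs_def)
  then have "1 \<le> j \<and> j \<le> k \<or> j = k + 1 \<or> j = k + 2 \<or> j = k + 3" using j by linarith
  then show ?thesis
  proof (elim disjE conjE)
    assume jk: "1 \<le> j" "j \<le> k"
    then have "b = 0" "c = j - 1" "2 \<le> j" using bc by (auto simp: wheel_nbrs_eq(1))
    then show ?thesis using jk by (simp add: p_def cross_def wheel_point_def of_nat_diff)
  next
    assume jk: "j = k + 1"
    then have "b = 0" "c = 1" using bc wheel_nbrs_eq(2) by auto
    then show ?thesis using jk k by (simp add: p_def cross_def wheel_point_def)
  next
    assume jk: "j = k + 2"
    then have "b = 0 \<and> c = k \<or> b = 0 \<and> c = k + 1 \<or> b = k \<and> c = k + 1"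
      using bc wheel_nbrs_eq(3)[of k] by auto
    then show ?thesis using jk k
      by (elim disjE conjE) (simp_all add: p_def cross_def wheel_point_def)
  next
    assume jk: "j = k + 3"
    then have "1 \<le> b" "c \<le> k + 2" using bc wheel_nbrs_eq(4)[of k] by simp_all
    then have "c \<le> k \<or> b \<le> k \<and> c = k + 1 \<or> b \<le> k \<and> c = k + 2 \<or> b = k + 1 \<and> c = k + 2"
      using bc(3) by linarith
    then show ?thesis using jk k \<open>1 \<le> b\<close> bc(3)
      by (elim disjE conjE) (simp_all add: p_def cross_def wheel_point_def algebra_simps)
  qed
qed

lemma planar_double_wheel: "2 \<le> k \<Longrightarrow> planar (double_wheel k)"
  unfolding double_wheel_def
proof (rule planar_back_graph[where p = "wheel_point k"])
  show "wheel_nbrs k j \<noteq> {}" if "0 < j" for j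
    using that by (auto simp: wheel_nbrs_def)
qed (use wheel_nbrs_subset wheel_visible wheel_cross in blast)+

lemma card_edges_double_wheel:
  assumes "2 \<le> k"
  shows "card (edges (double_wheel k)) = 3 * (k + 4) - 6"
proof -
  have "(\<Sum>j<m + 1. card (wheel_nbrs k j)) = 2 * m - 1" if "1 \<le> m" "m \<le> k" for m
    using that
  proof (induction m rule: dec_induct)
    case (step m)
    then show ?case by (simp add: wheel_nbrs_def)
  qed (simp add: wheel_nbrs_def)
  from this[of k] have "(\<Sum>j<k + 4. card (wheel_nbrs k j)) = 3 * (k + 4) - 6"
    using assms by (simp add: wheel_nbrs_def numeral_eq_Suc)
  then show ?thesis
    using assms by (simp add: double_wheel_def card_edges_back_graph wheel_nbrs_subset)
qed

section \<open>Forbidden induced subgraphs\<close>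

text \<open>This turns the isomorphism in \<open>contains_induced\<close> round: maps out of
  \<open>F\<close> compose, so whatever \<open>F\<close> contains as an induced subgraph is carried
  into the host.\<close>

definition induced_embedding :: "('a \<Rightarrow> 'b) \<Rightarrow> 'a ugraph \<Rightarrow> 'b ugraph \<Rightarrow> bool" where
  "induced_embedding f F G \<longleftrightarrow> inj_on f (verts F) \<and> f ` verts F \<subseteq> verts G \<and>
     (\<forall>u\<in>verts F. \<forall>v\<in>verts F. {u, v} \<in> edges F \<longleftrightarrow> {f u, f v} \<in> edges G)"

lemma contains_induced_imp_embedding:
  assumes "contains_induced G F"
  shows "\<exists>f. induced_embedding f F G"
proof -
  obtain S h where S: "S \<subseteq> verts G" and h: "bij_betw h S (verts F)"
    and adj: "\<And>u v. u \<in> S \<Longrightarrow> v \<in> S \<Longrightarrow> {u, v} \<in> edges G \<longleftrightarrow> {h u, h v} \<in> edges F"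
    using assms by (auto simp: contains_induced_def isomorphic_def induced_subgraph_def)
  let ?f = "inv_into S h"
  have f: "bij_betw ?f (verts F) S" using h by (rule bij_betw_inv_into)
  have "induced_embedding ?f F G"
    unfolding induced_embedding_def
  proof (intro conjI ballI)
    show "inj_on ?f (verts F)" using f by (rule bij_betw_imp_inj_on)
    show "?f ` verts F \<subseteq> verts G" using f S by (simp add: bij_betw_imp_surj_on)
    fix u v assume "u \<in> verts F" "v \<in> verts F"
    then show "{u, v} \<in> edges F \<longleftrightarrow> {?f u, ?f v} \<in> edges G"
      using adj[of "?f u" "?f v"] f h by (simp add: bij_betwE bij_betw_inv_into_right)
  qed
  then show ?thesis by blast
qed

lemma induced_embedding_comp:
  assumes f: "induced_embedding f F G" and g: "induced_embedding g H F"
  shows "induced_embedding (f \<circ> g) H G"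
  unfolding induced_embedding_def
proof (intro conjI ballI)
  have sub: "g ` verts H \<subseteq> verts F" using g by (simp add: induced_embedding_def)
  have "inj_on f (g ` verts H)"
    using f inj_on_subset[OF _ sub] by (auto simp: induced_embedding_def)
  then show "inj_on (f \<circ> g) (verts H)"
    using g by (intro comp_inj_on) (simp_all add: induced_embedding_def)
  show "(f \<circ> g) ` verts H \<subseteq> verts G"
    using f sub by (auto simp: induced_embedding_def)
  show "{u, v} \<in> edges H \<longleftrightarrow> {(f \<circ> g) u, (f \<circ> g) v} \<in> edges G"
    if "u \<in> verts H" "v \<in> verts H" for u v
  proof -
    have "g u \<in> verts F" "g v \<in> verts F" using sub that by auto
    then show ?thesis using f g that by (simp add: induced_embedding_def)
  qed
qed

lemma induced_embedding_edge_iff: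
  "induced_embedding f F G \<Longrightarrow> u \<in> verts F \<Longrightarrow> v \<in> verts F \<Longrightarrow>
    {f u, f v} \<in> edges G \<longleftrightarrow> {u, v} \<in> edges F"
  by (simp add: induced_embedding_def)

lemma induced_embedding_neq:
  "induced_embedding f F G \<Longrightarrow> u \<in> verts F \<Longrightarrow> v \<in> verts F \<Longrightarrow> u \<noteq> v \<Longrightarrow> f u \<noteq> f v"
  by (auto simp: induced_embedding_def inj_on_def)

lemma induced_embedding_mem:
  "induced_embedding f F G \<Longrightarrow> u \<in> verts F \<Longrightarrow> f u \<in> verts G"
  by (auto simp: induced_embedding_def)

lemma induced_embedding_card_le:
  "induced_embedding f F G \<Longrightarrow> finite (verts G) \<Longrightarrow> card (verts F) \<le> card (verts G)"
  by (auto simp: induced_embedding_def intro: card_inj_on_le)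

section \<open>Cliques and complete graphs\<close>

definition clique :: "'a ugraph \<Rightarrow> 'a set \<Rightarrow> bool" where
  "clique G Q \<longleftrightarrow> Q \<subseteq> verts G \<and> (\<forall>x\<in>Q. \<forall>y\<in>Q. x \<noteq> y \<longrightarrow> {x, y} \<in> edges G)"

lemma clique_image:
  assumes "induced_embedding f F G" "clique F Q"
  shows "clique G (f ` Q)" "card (f ` Q) = card Q"
proof -
  have Q: "Q \<subseteq> verts F" using assms(2) by (simp add: clique_def)
  show "clique G (f ` Q)"
    unfolding clique_def
  proof (intro conjI ballI impI)
    show "f ` Q \<subseteq> verts G" using assms(1) Q by (auto simp: induced_embedding_def)
    fix x y assume "x \<in> f ` Q" "y \<in> f ` Q" "x \<noteq> y"
    then obtain a b where ab: "a \<in> Q" "b \<in> Q" "x = f a" "y = f b" "a \<noteq> b" by auto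
    then have "{a, b} \<in> edges F" using assms(2) by (simp add: clique_def)
    then show "{x, y} \<in> edges G"
      using induced_embedding_edge_iff[OF assms(1), of a b] ab Q by auto
  qed
  have "inj_on f Q" using assms(1) Q inj_on_subset by (auto simp: induced_embedding_def)
  then show "card (f ` Q) = card Q" by (rule card_image)
qed

lemma complete_graph_edge_iff: "{u, v} \<in> edges (complete_graph m) \<longleftrightarrow> u < m \<and> v < m \<and> u \<noteq> v"
  by (auto simp: complete_graph_def card_insert_if)

text \<open>Containment in case (i) is not induced, but a complete subgraph is a clique, and cliques
  survive induced embeddings.\<close>

lemma contains_complete_imp_clique:
  assumes "contains G (complete_graph m)"
  shows "\<exists>Q. clique G Q \<and> card Q = m"
proof -
  obtain H h where H: "verts H \<subseteq> verts G" "edges H \<subseteq> edges G"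
    and h: "bij_betw h (verts H) {..<m}"
    and adj: "\<And>u v. u \<in> verts H \<Longrightarrow> v \<in> verts H \<Longrightarrow>
      {u, v} \<in> edges H \<longleftrightarrow> {h u, h v} \<in> edges (complete_graph m)"
    using assms unfolding contains_def subgraph_def isomorphic_def
    by (auto simp: complete_graph_def)
  have "{u, v} \<in> edges G" if "u \<in> verts H" "v \<in> verts H" "u \<noteq> v" for u v
  proof -
    have "h u < m" "h v < m" using h that(1,2) by (auto dest: bij_betwE)
    moreover have "h u \<noteq> h v" using h that by (auto simp: bij_betw_def inj_on_def)
    ultimately show ?thesis using adj[OF that(1,2)] H(2) by (auto simp: complete_graph_edge_iff)
  qed
  then have "clique G (verts H)" using H by (auto simp: clique_def)
  moreover have "card (verts H) = m" using bij_betw_same_card[OF h] by simp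
  ultimately show ?thesis by blast
qed

lemma complete_graph_isomorphic:
  assumes G: "simple_graph G" and cl: "clique G (verts G)" and m: "card (verts G) = m"
  shows "isomorphic G (complete_graph m)"
proof -
  have "finite (verts G)" using G by (simp add: simple_graph_def)
  then obtain h where h: "bij_betw h (verts G) {..<m}"
    using ex_bij_betw_finite_nat m by (metis atLeast0LessThan)
  have "{u, v} \<in> edges G \<longleftrightarrow> {h u, h v} \<in> edges (complete_graph m)"
    if "u \<in> verts G" "v \<in> verts G" for u v
  proof -
    have "{u, v} \<in> edges G \<longleftrightarrow> u \<noteq> v"
      using G cl that by (fastforce simp: simple_graph_def clique_def)
    moreover have "h u < m" "h v < m" using h that by (auto dest: bij_betwE)
    moreover have "h u = h v \<longleftrightarrow> u = v" using h that by (auto simp: bij_betw_def inj_on_def)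
    ultimately show ?thesis by (simp add: complete_graph_edge_iff)
  qed
  then show ?thesis using h by (auto simp: isomorphic_def complete_graph_def)
qed

section \<open>Induced subgraphs of the cube of a path\<close>

lemma simple_path_cube: "simple_graph (path_cube n)"
  using cube_nbrs_subset by (simp add: path_cube_def simple_back_graph)

lemma verts_path_cube [simp]: "verts (path_cube n) = {..<n}"
  by (simp add: path_cube_def)

lemma path_cube_edge_iff:
  assumes "u < n" "v < n" "u \<noteq> v"
  shows "{u, v} \<in> edges (path_cube n) \<longleftrightarrow> u \<le> v + 3 \<and> v \<le> u + 3"
proof -
  have *: "{i, j} \<in> edges (path_cube n) \<longleftrightarrow> j \<le> i + 3" if "i < j" "j < n" for i j
    using edge_back_graph_iff[of n cube_nbrs i j] cube_nbrs_subset that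
    by (simp add: path_cube_def cube_nbrs_def)
  show ?thesis using *[of u v] *[of v u] assms by (cases "u < v") (auto simp: insert_commute)
qed

lemma cycle_graph_edge_iff:
  assumes "2 \<le> k" "u < k" "v < k"
  shows "{u, v} \<in> edges (cycle_graph k) \<longleftrightarrow>
    v = Suc u \<or> u = Suc v \<or> u = 0 \<and> v = k - 1 \<or> v = 0 \<and> u = k - 1"
proof -
  have "{u, v} \<in> edges (cycle_graph k) \<longleftrightarrow> v = Suc u mod k \<or> u = Suc v mod k"
    using assms by (auto simp: cycle_graph_def doubleton_eq_iff)
  moreover have "Suc i mod k = (if i = k - 1 then 0 else Suc i)" if "i < k" for i
    using that assms(1) by auto
  ultimately show ?thesis using assms by auto
qed

text \<open>The two cycle neighbours of the largest vertex lie among its three predecessors, which are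
  pairwise adjacent.\<close>

lemma path_cube_no_induced_cycle:
  assumes "4 \<le> k"
  shows "\<not> induced_embedding g (cycle_graph k) (path_cube n)"
proof
  assume emb: "induced_embedding g (cycle_graph k) (path_cube n)"
  have verts: "verts (cycle_graph k) = {..<k}" by (simp add: cycle_graph_def)
  have "finite (g ` {..<k})" "g ` {..<k} \<noteq> {}"
    using assms by (simp_all add: lessThan_empty_iff)
  then have "Max (g ` {..<k}) \<in> g ` {..<k}" by (rule Max_in)
  then obtain a where a: "a < k" "g a = Max (g ` {..<k})" by auto
  have g_le: "g i \<le> g a" if "i < k" for i using that a by simp
  define b where "b = (if a = k - 1 then 0 else Suc a)"
  define c where "c = (if a = 0 then k - 1 else a - 1)"
  have bc: "b < k" "c < k" "b \<noteq> a" "c \<noteq> a" "b \<noteq> c"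
    using a assms by (auto simp: b_def c_def)
  have edge: "{g a, g b} \<in> edges (path_cube n)" "{g a, g c} \<in> edges (path_cube n)"
    "{g b, g c} \<notin> edges (path_cube n)"
    using induced_embedding_edge_iff[OF emb] verts a(1) bc assms
    by (auto simp: cycle_graph_edge_iff b_def c_def split: if_splits)
  have lt: "g a < n" "g b < n" "g c < n"
    using induced_embedding_mem[OF emb] verts a(1) bc by auto
  have neq: "g a \<noteq> g b" "g a \<noteq> g c" "g b \<noteq> g c"
    using induced_embedding_neq[OF emb] verts a(1) bc by auto
  show False
    using edge lt neq g_le[OF bc(1)] g_le[OF bc(2)] by (simp add: path_cube_edge_iff)
qed

text \<open>Of three leaves two lie on the same side of the centre; both are within 3 of it, so they
  differ by at most 2 and are adjacent.\<close>

lemma path_cube_no_induced_star: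
  assumes "3 \<le> k"
  shows "\<not> induced_embedding g (star_graph k) (path_cube n)"
proof
  assume emb: "induced_embedding g (star_graph k) (path_cube n)"
  have mem: "i \<in> verts (star_graph k)" if "i \<le> 3" for i
    using that assms by (simp add: star_graph_def)
  have lt: "g i < n" if "i \<le> 3" for i
    using induced_embedding_mem[OF emb mem[OF that]] by simp
  have neq: "g i \<noteq> g j" if "i < j" "j \<le> 3" for i j
    using induced_embedding_neq[OF emb] mem that by simp
  have spoke: "{g 0, g i} \<in> edges (path_cube n)" if "1 \<le> i" "i \<le> 3" for i
  proof -
    have "{0, i} \<in> edges (star_graph k)"
      unfolding star_graph_def ugraph.sel using that assms by (intro CollectI exI[of _ i]) simp
    then show ?thesis using induced_embedding_edge_iff[OF emb, of 0 i] mem that by simp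
  qed
  have far: "{g i, g j} \<notin> edges (path_cube n)" if "1 \<le> i" "i < j" "j \<le> 3" for i j
    using induced_embedding_edge_iff[OF emb, of i j] mem that
    by (auto simp: star_graph_def doubleton_eq_iff)
  have near: "g 0 \<le> g i + 3 \<and> g i \<le> g 0 + 3" if "1 \<le> i" "i \<le> 3" for i
    using spoke[OF that] lt[of 0] lt[of i] neq[of 0 i] that by (simp add: path_cube_edge_iff)
  have apart: "g i + 3 < g j \<or> g j + 3 < g i" if "1 \<le> i" "i < j" "j \<le> 3" for i j
    using far[OF that] lt[of i] lt[of j] neq[of i j] that by (auto simp: path_cube_edge_iff)
  show False
    using near[of 1] near[of 2] near[of 3] apart[of 1 2] apart[of 1 3] apart[of 2 3] by simp linarith
qed

text \<open>The only two vertices more than 3 apart are \<open>0\<close> and \<open>4\<close>;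
  swapping \<open>1\<close> and \<open>4\<close> moves this missing edge to
  \<open>{0, 1}\<close>.\<close>

lemma path_cube_5_isomorphic:
  "isomorphic (path_cube 5) (delete_edge (complete_graph 5) {0, 1})"
  unfolding isomorphic_def
proof (intro exI conjI ballI)
  let ?s = "id(1 := 4, 4 := 1 :: nat)"
  have five: "{..<5} = {0, 1, 2, 3, 4 :: nat}" by auto
  show "bij_betw ?s (verts (path_cube 5)) (verts (delete_edge (complete_graph 5) {0, 1}))"
    by (auto simp: bij_betw_def inj_on_def delete_edge_def complete_graph_def five)
  fix u v assume uv: "u \<in> verts (path_cube 5)" "v \<in> verts (path_cube 5)"
  have target: "{x, y} \<in> edges (delete_edge (complete_graph 5) {0, 1}) \<longleftrightarrow>
      x < 5 \<and> y < 5 \<and> x \<noteq> y \<and> {x, y} \<noteq> {0, 1}" for x y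
    using complete_graph_edge_iff[of x y 5] by (auto simp: delete_edge_def)
  show "{u, v} \<in> edges (path_cube 5) \<longleftrightarrow> {?s u, ?s v} \<in> edges (delete_edge (complete_graph 5) {0, 1})"
  proof (cases "u = v")
    case True
    have "{v, v} \<notin> edges (path_cube 5)" using simple_path_cube[of 5] by (auto simp: simple_graph_def)
    then show ?thesis using target[of "?s v" "?s v"] True by (simp del: fun_upd_apply)
  next
    case False
    then have "{u, v} \<in> edges (path_cube 5) \<longleftrightarrow> u \<le> v + 3 \<and> v \<le> u + 3"
      using uv by (intro path_cube_edge_iff) simp_all
    moreover have "u \<in> {0, 1, 2, 3, 4}" "v \<in> {0, 1, 2, 3, 4}" using uv by auto
    ultimately show ?thesis
      using False unfolding target doubleton_eq_iff by (elim insertE emptyE) simp_all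
  qed
qed

lemma isomorphic_trans:
  assumes "isomorphic G H" "isomorphic H K"
  shows "isomorphic G K"
proof -
  obtain f g where f: "bij_betw f (verts G) (verts H)"
    "\<forall>u\<in>verts G. \<forall>v\<in>verts G. {u, v} \<in> edges G \<longleftrightarrow> {f u, f v} \<in> edges H"
    and g: "bij_betw g (verts H) (verts K)"
    "\<forall>u\<in>verts H. \<forall>v\<in>verts H. {u, v} \<in> edges H \<longleftrightarrow> {g u, g v} \<in> edges K"
    using assms by (auto simp: isomorphic_def)
  have "f u \<in> verts H" if "u \<in> verts G" for u using f(1) that by (rule bij_betw_apply)
  then show ?thesis
    unfolding isomorphic_def
    using f g by (intro exI[of _ "g \<circ> f"]) (auto intro: bij_betw_trans)
qed

text \<open>At most five vertices leave little room: with four vertices \<open>F\<close> is its own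
  clique \<open>Q\<close>, with five it is all of \<open>path_cube 5\<close>, and the last two
  hypotheses exclude exactly these.\<close>

lemma small_path_cube_no_clique_4:
  assumes F: "simple_graph F" and emb: "induced_embedding f F (path_cube n)" and n: "n \<le> 5"
    and Q: "clique F Q" "card Q = 4"
    and K4: "\<not> (n \<in> {4, 5} \<and> isomorphic F (complete_graph 4))"
    and K5: "\<not> (n = 5 \<and> isomorphic F (delete_edge (complete_graph 5) {0, 1}))"
  shows False
proof -
  have fin: "finite (verts F)" using F by (simp add: simple_graph_def)
  have le_n: "card (verts F) \<le> n" using induced_embedding_card_le[OF emb] by simp
  have Q_sub: "Q \<subseteq> verts F" using Q by (simp add: clique_def)
  then have ge_4: "4 \<le> card (verts F)" using card_mono[OF fin Q_sub] Q by simp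
  show False
  proof (cases "card (verts F) = 4")
    case True
    then have "Q = verts F" using Q_sub Q(2) fin by (simp add: card_subset_eq)
    then have "isomorphic F (complete_graph 4)"
      using complete_graph_isomorphic[OF F] Q True by simp
    then show False using K4 n le_n True by auto
  next
    case False
    then have 5: "card (verts F) = 5" "n = 5" using ge_4 le_n n by auto
    have inj: "inj_on f (verts F)" and "f ` verts F \<subseteq> {..<5}"
      using emb 5 by (auto simp: induced_embedding_def)
    moreover have "card (f ` verts F) = card {..<5::nat}" using card_image[OF inj] 5 by simp
    ultimately have "f ` verts F = {..<5}" by (intro card_subset_eq) simp_all
    then have "isomorphic F (path_cube 5)"
      using emb inj 5 by (auto simp: isomorphic_def induced_embedding_def bij_betw_def)
    then show False using isomorphic_trans path_cube_5_isomorphic K5 5 by blast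
  qed
qed

section \<open>Triangles and cliques in the double wheel\<close>

lemma simple_double_wheel: "2 \<le> k \<Longrightarrow> simple_graph (double_wheel k)"
  by (simp add: double_wheel_def simple_back_graph wheel_nbrs_subset)

lemma verts_double_wheel [simp]: "verts (double_wheel k) = {..<k + 4}"
  by (simp add: double_wheel_def)

lemma double_wheel_edge_iff:
  "2 \<le> k \<Longrightarrow> i < j \<Longrightarrow> j < k + 4 \<Longrightarrow> {i, j} \<in> edges (double_wheel k) \<longleftrightarrow> i \<in> wheel_nbrs k j"
  using edge_back_graph_iff[of "k + 4" "wheel_nbrs k" i j] wheel_nbrs_subset
  by (simp add: double_wheel_def)

text \<open>The rim is a cycle of length \<open>k + 2\<close>, at least 4. The largest vertex of a
  triangle would have two smaller rim neighbours; only \<open>k + 2\<close> does, namely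
  \<open>k\<close> and \<open>k + 1\<close>, and these are nonadjacent because
  \<open>k \<ge> 2\<close>.\<close>

lemma double_wheel_rim_triangle_free:
  assumes k: "2 \<le> k" and Q: "clique (double_wheel k) Q" "Q \<inter> {0, k + 3} = {}"
  shows "card Q < 3"
proof (rule ccontr)
  assume "\<not> card Q < 3"
  then obtain T where T: "T \<subseteq> Q" "card T = 3"
    by (metis linorder_not_less obtain_subset_with_card_n)
  have bound: "v < k + 4" if "v \<in> Q" for v using Q(1) that by (auto simp: clique_def)
  have nbr: "u \<in> wheel_nbrs k v" if "u \<in> Q" "v \<in> Q" "u < v" for u v
  proof -
    have "{u, v} \<in> edges (double_wheel k)" using Q(1) that by (simp add: clique_def)
    then show ?thesis using double_wheel_edge_iff[OF k that(3) bound[OF that(2)]] by simp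
  qed
  have ordered: False if xyz: "x \<in> Q" "y \<in> Q" "z \<in> Q" "x < y" "y < z" for x y z
  proof -
    have "0 \<notin> Q" "k + 3 \<notin> Q" using Q(2) by auto
    then have "x \<noteq> 0" "z \<noteq> k + 3" using xyz by metis+
    have xy: "x \<in> wheel_nbrs k y" and xz: "x \<in> wheel_nbrs k z" and yz: "y \<in> wheel_nbrs k z"
      using nbr xyz less_trans by blast+
    have "z \<le> k \<or> z = k + 1 \<or> z = k + 2" using bound[OF xyz(3)] \<open>z \<noteq> k + 3\<close> by linarith
    then show False
    proof (elim disjE)
      assume "z \<le> k"
      then have "wheel_nbrs k z = {0, z - 1}" using xyz by (intro wheel_nbrs_eq) simp_all
      then show False using xz yz xyz(4) \<open>x \<noteq> 0\<close> by simp
    next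
      assume "z = k + 1"
      then show False using xz yz xyz(4) \<open>x \<noteq> 0\<close> wheel_nbrs_eq(2)[of k] by simp
    next
      assume "z = k + 2"
      then have "x = k" "y = k + 1" using xz yz xyz(4,5) \<open>x \<noteq> 0\<close> wheel_nbrs_eq(3)[of k] by auto
      then show False using xy k wheel_nbrs_eq(2)[of k] by simp
    qed
  qed
  obtain x y z where xyz: "T = {x, y, z}" "x \<noteq> y" "x \<noteq> z" "y \<noteq> z"
    using T(2) by (auto simp: card_3_iff)
  then have "x \<in> Q" "y \<in> Q" "z \<in> Q" using T by auto
  then show False
    using xyz ordered by (metis linorder_neqE_nat)
qed

lemma double_wheel_apexes:
  assumes "2 \<le> k"
  shows "{0, k + 3} \<notin> edges (double_wheel k)"
    and "1 \<le> v \<Longrightarrow> v \<le> k + 2 \<Longrightarrow> s \<in> {0, k + 3} \<Longrightarrow> {s, v} \<in> edges (double_wheel k)"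
proof -
  show "{0, k + 3} \<notin> edges (double_wheel k)"
    using double_wheel_edge_iff[OF assms, of 0 "k + 3"] wheel_nbrs_eq(4)[of k] by simp
  assume v: "1 \<le> v" "v \<le> k + 2" "s \<in> {0, k + 3}"
  then have "v \<le> k \<or> v = k + 1 \<or> v = k + 2" by linarith
  then have "0 \<in> wheel_nbrs k v"
    using v wheel_nbrs_eq(2,3)[of k] by (elim disjE) (simp_all add: wheel_nbrs_eq(1))
  then have "{0, v} \<in> edges (double_wheel k)"
    using double_wheel_edge_iff[OF assms, of 0 v] v by simp
  moreover have "{v, k + 3} \<in> edges (double_wheel k)"
    using double_wheel_edge_iff[OF assms, of v "k + 3"] v wheel_nbrs_eq(4)[of k] by simp
  ultimately show "{s, v} \<in> edges (double_wheel k)" using v(3) by (auto simp: insert_commute)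
qed

lemma double_wheel_clique_card:
  assumes k: "2 \<le> k" and Q: "clique (double_wheel k) Q"
  shows "card Q < 4"
proof -
  have "finite Q" using Q by (auto simp: clique_def intro: finite_subset)
  have "clique (double_wheel k) (Q - {0, k + 3})" using Q by (auto simp: clique_def)
  then have "card (Q - {0, k + 3}) < 3" using double_wheel_rim_triangle_free[OF k] by blast
  moreover have "\<not> {0, k + 3} \<subseteq> Q"
    using Q double_wheel_apexes(1)[OF k] by (auto simp: clique_def)
  then have "Q \<inter> {0, k + 3} \<subseteq> {0} \<or> Q \<inter> {0, k + 3} \<subseteq> {k + 3}" by blast
  then have "card (Q \<inter> {0, k + 3}) \<le> 1"
    by (metis card.empty card.insert card_mono empty_iff finite.emptyI finite.insertI One_nat_def)
  moreover have "card Q = card (Q \<inter> {0, k + 3}) + card (Q - {0, k + 3})"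
    using \<open>finite Q\<close> by (rule card_Int_Diff)
  ultimately show ?thesis by linarith
qed

lemma double_wheel_no_induced_2K3:
  assumes k: "2 \<le> k"
  shows "\<not> induced_embedding g (disjoint_union (complete_graph 3) (complete_graph 3)) (double_wheel k)"
proof
  let ?U = "disjoint_union (complete_graph 3) (complete_graph 3)"
  assume emb: "induced_embedding g ?U (double_wheel k)"
  have verts: "verts ?U = Inl ` {..<3} \<union> Inr ` {..<3}"
    by (simp add: disjoint_union_def complete_graph_def)
  have left: "{Inl i, Inl j} \<in> edges ?U" if "i < 3" "j < 3" "i \<noteq> j" for i j
  proof -
    have "{i, j} \<in> edges (complete_graph 3)" using that by (simp add: complete_graph_edge_iff)
    then have "Inl ` {i, j} \<in> edges ?U" unfolding disjoint_union_def by (simp del: image_insert)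
    then show ?thesis by simp
  qed
  have cross_pair: "{Inl i, Inr j} \<notin> edges ?U" for i j
    by (auto simp: disjoint_union_def)
  have clique: "clique ?U (Inl ` {..<3})" using verts left by (auto simp: clique_def)
  have "card (g ` Inl ` {..<3}) = 3"
    using clique_image(2)[OF emb clique] by (simp add: card_image)
  then have "g ` Inl ` {..<3} \<inter> {0, k + 3} \<noteq> {}"
    using double_wheel_rim_triangle_free[OF k clique_image(1)[OF emb clique]] by linarith
  then obtain i where i: "i < 3" "g (Inl i) \<in> {0, k + 3}" by auto
  \<comment> \<open>The hub in the left triangle is adjacent to the entire rim, so every vertex of
    the right triangle would have to be the other hub.\<close>
  have apex: "g (Inr j) \<in> {0, k + 3} - {g (Inl i)}" if "j < 3" for j
  proof -
    have mem: "Inl i \<in> verts ?U" "Inr j \<in> verts ?U" using verts i that by auto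
    have "{g (Inl i), g (Inr j)} \<notin> edges (double_wheel k)"
      using induced_embedding_edge_iff[OF emb mem] cross_pair by simp
    then have "\<not> (1 \<le> g (Inr j) \<and> g (Inr j) \<le> k + 2)"
      using double_wheel_apexes(2)[OF k _ _ i(2)] by blast
    moreover have "g (Inr j) < k + 4" using induced_embedding_mem[OF emb mem(2)] by simp
    moreover have "g (Inl i) \<noteq> g (Inr j)" using induced_embedding_neq[OF emb mem] by simp
    ultimately show ?thesis by auto
  qed
  have "g (Inr 0) = g (Inr 1)" using apex[of 0] apex[of 1] i(2) by auto
  moreover have "g (Inr 0) \<noteq> g (Inr 1)" using verts by (intro induced_embedding_neq[OF emb]) auto
  ultimately show False by contradiction
qed

section \<open>The extremal number\<close>

lemma ex_planar_induced_eq: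
  fixes F :: "'a ugraph" and G :: "nat ugraph"
  assumes n: "3 \<le> n" and G: "simple_graph G" "card (verts G) = n" "planar G" "induced_free F G"
    and card: "card (edges G) = 3 * n - 6"
  shows "ex_planar_induced n F = 3 * n - 6"
proof -
  let ?S = "{card (edges G) | G :: nat ugraph.
            simple_graph G \<and> card (verts G) = n \<and> planar G \<and> induced_free F G}"
  have le: "m \<le> 3 * n - 6" if "m \<in> ?S" for m
    using that n planar_card_edges_le by auto
  have "finite ?S" using le by (intro finite_subset[of ?S "{..3 * n - 6}"]) auto
  moreover have "3 * n - 6 \<in> ?S" using G card by force
  ultimately show ?thesis
    unfolding ex_planar_induced_def using le by (intro Max_eqI)
qed

theorem proposition1p2:
  fixes F :: "'a ugraph" and n :: nat
  assumes "simple_graph F"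
    and "n \<ge> 3"
    and "contains F (complete_graph 4)
       \<or> (\<exists>k\<ge>4. contains_induced F (cycle_graph k))
       \<or> (\<exists>k\<ge>3. contains_induced F (star_graph k))
       \<or> contains_induced F (disjoint_union (complete_graph 3) (complete_graph 3))"
    and "\<not> (n \<in> {4, 5} \<and> isomorphic F (complete_graph 4))"
    and "\<not> (n = 5 \<and> isomorphic F (delete_edge (complete_graph 5) {0, 1}))"
  shows "ex_planar_induced n F = 3 * n - 6"
proof -
  let ?U = "disjoint_union (complete_graph 3) (complete_graph 3)"
  have path_cube: ?thesis if "\<nexists>f. induced_embedding f F (path_cube n)"
  proof (rule ex_planar_induced_eq[OF \<open>n \<ge> 3\<close> simple_path_cube _ planar_path_cube])
    show "induced_free F (path_cube n)"
      using that contains_induced_imp_embedding by (auto simp: induced_free_def)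
  qed (simp_all add: card_edges_path_cube \<open>n \<ge> 3\<close>)
  have double_wheel: ?thesis if "n = k + 4" "2 \<le> k" "\<nexists>f. induced_embedding f F (double_wheel k)" for k
  proof (rule ex_planar_induced_eq[OF \<open>n \<ge> 3\<close> simple_double_wheel _ planar_double_wheel])
    show "induced_free F (double_wheel k)"
      using that(3) contains_induced_imp_embedding by (auto simp: induced_free_def)
  qed (simp_all add: card_edges_double_wheel that)
  have no_emb: "\<nexists>f. induced_embedding f F G"
    if "contains_induced F H" "\<And>g. \<not> induced_embedding g H G" for G :: "nat ugraph" and H :: "'b ugraph"
    using that contains_induced_imp_embedding induced_embedding_comp by blast
  consider (K4) "contains F (complete_graph 4)"
    | (cycle) k where "k \<ge> 4" "contains_induced F (cycle_graph k)"
    | (star) k where "k \<ge> 3" "contains_induced F (star_graph k)"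
    | (triangles) "contains_induced F ?U"
    using assms(3) by blast
  then show ?thesis
  proof cases
    case K4
    then obtain Q where Q: "clique F Q" "card Q = 4" using contains_complete_imp_clique by blast
    show ?thesis
    proof (cases "n \<le> 5")
      case True
      then show ?thesis
        using small_path_cube_no_clique_4[OF assms(1) _ _ Q assms(4,5)] by (intro path_cube) blast
    next
      case False
      \<comment> \<open>With \<open>k = n - 4\<close>, the condition \<open>2 \<le> k\<close> says
        that the rim has at least four vertices.\<close>
      then have n: "n = n - 4 + 4" "2 \<le> n - 4" by simp_all
      have "\<not> induced_embedding f F (double_wheel (n - 4))" for f
        using clique_image[of f F _ Q] Q double_wheel_clique_card[OF n(2), of "f ` Q"] by auto
      then show ?thesis using double_wheel[OF n] by blast
    qed
  next
    case cycle
    then show ?thesis using no_emb path_cube_no_induced_cycle by (intro path_cube) blast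
  next
    case star
    then show ?thesis using no_emb path_cube_no_induced_star by (intro path_cube) blast
  next
    case triangles
    show ?thesis
    proof (cases "n \<le> 5")
      case True
      have "verts ?U = {..<3} <+> {..<3}"
        by (simp add: disjoint_union_def complete_graph_def Plus_def)
      then have "card (verts ?U) = 6" by (simp add: card_Plus)
      then have "\<not> induced_embedding g ?U (path_cube n)" for g
        using induced_embedding_card_le[of g ?U "path_cube n"] True by auto
      then show ?thesis by (intro path_cube no_emb[OF triangles])
    next
      case False
      then have n: "n = n - 4 + 4" "2 \<le> n - 4" by simp_all
      show ?thesis
        using double_wheel_no_induced_2K3[OF n(2)] by (intro double_wheel[OF n] no_emb[OF triangles])
    qed
  qed
qed

end
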